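(* Let $\{X_n,n\ge1\}$ be a sequence of pairwise negatively dependent, identically distributed real random variables, and let $X$ be a random variable with the same distribution as the $X_n$. Let $L(\cdot)$ be a slowly varying function defined on $[A,\infty)$ for some $A>0$, with de Bruijn conjugate $\tilde L(\cdot)$, also defined on $[A,\infty)$, where $L$ and $\tilde L$ are both bounded on finite closed intervals. Assume that $\tilde L(x)\uparrow\infty$ as $x\to\infty$ (i.e., $\tilde L$ is nondecreasing and tends to infinity). Then the following statements are equivalent. (i) $E\left(|X|L(|X|+A)\right)<\infty$. (ii) $$\sum_{n\ge A}n^{-1}P\left(\max_{1\le k\le n}\left|\sum_{i=1}^kX_i\right|>\varepsilon n\tilde L(n)\right)<\infty\quad\text{for all }\varepsilon>0.$$ (iii) $$\lim_{n\to\infty}\frac{\sum_{i=1}^n|X_i|}{n\tilde L(n)}=0\quad\text{almost surely.}$$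
   Context: Sums over $n\ge A$ run over positive integers $n$ with $n\ge A$. Slowly varying: a function $L:[A,\infty)\to(0,\infty)$, $A>0$, that is positive and measurable with $\lim_{x\to\infty}L(\lambda x)/L(x)=1$ for every $\lambda>0$. De Bruijn conjugate: for a slowly varying $L$ there is a slowly varying function $\tilde L$, unique up to asymptotic equivalence, such that $\lim_{x\to\infty}L(x)\tilde L(xL(x))=1$ and $\lim_{x\to\infty}\tilde L(x)L(x\tilde L(x))=1$. It is called the de Bruijn conjugate of $L$. Pairwise negative dependence: a sequence $\{X_i,i\ge1\}$ of random variables is pairwise negatively dependent if for all $x,y\in\mathbb{R}$ and all $i\ne j$, $P(X_i\le x,X_j\le y)\le P(X_i\le x)P(X_j\le y)$. *)

theory Defs
  imports "HOL-Probability.Probability"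
begin

text \<open>
  A function on \<open>[A, \<infinity>)\<close> is a total function \<open>real \<Rightarrow> real\<close> whose values below \<open>A\<close> are
  unconstrained.  No condition below depends on those values: \<open>c x \<rightarrow> \<infinity>\<close>, and \<open>x L(x) \<rightarrow> \<infinity>\<close>
  for slowly varying \<open>L\<close>, so the arguments in the limits eventually lie in the domain.
  Measurability means Borel measurability, so that \<open>L(|X| + A)\<close> is a random variable.
\<close>

definition slowly_varying :: "real \<Rightarrow> (real \<Rightarrow> real) \<Rightarrow> bool" where
  "slowly_varying A L \<longleftrightarrow>
     A > 0 \<and> (\<forall>x\<ge>A. L x > 0) \<and> L \<in> borel_measurable (restrict_space borel {A..}) \<and>
     (\<forall>c>0. ((\<lambda>x. L (c * x) / L x) \<longlongrightarrow> 1) at_top)"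

text \<open>The conjugate is unique only up to asymptotic equivalence, hence a relation.\<close>

definition de_Bruijn_conjugate :: "real \<Rightarrow> (real \<Rightarrow> real) \<Rightarrow> (real \<Rightarrow> real) \<Rightarrow> bool" where
  "de_Bruijn_conjugate A L Lt \<longleftrightarrow>
     slowly_varying A L \<and> slowly_varying A Lt \<and>
     ((\<lambda>x. L x * Lt (x * L x)) \<longlongrightarrow> 1) at_top \<and>
     ((\<lambda>x. Lt x * L (x * Lt x)) \<longlongrightarrow> 1) at_top"

definition pairwise_neg_dependent ::
    "'a measure \<Rightarrow> ('i \<Rightarrow> 'a \<Rightarrow> real) \<Rightarrow> 'i set \<Rightarrow> bool" where
  "pairwise_neg_dependent M X I \<longleftrightarrow>
     (\<forall>i\<in>I. X i \<in> borel_measurable M) \<and>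
     (\<forall>i\<in>I. \<forall>j\<in>I. i \<noteq> j \<longrightarrow> (\<forall>x y.
        \<P>(\<omega> in M. X i \<omega> \<le> x \<and> X j \<omega> \<le> y) \<le> \<P>(\<omega> in M. X i \<omega> \<le> x) * \<P>(\<omega> in M. X j \<omega> \<le> y)))"

end

theory Submission
  imports Defs
begin

text \<open>
  Put \<open>b(n) = n Lt(n)\<close> and let \<open>\<kappa>(x)\<close> be the first \<open>n \<ge> A\<close> with \<open>b(n) \<ge> x\<close>.  The conjugacy relation
  \<open>Lt(x) L(x Lt(x)) \<rightarrow> 1\<close> says that \<open>x L(x)\<close> inverts \<open>b\<close> asymptotically, so with the uniform
  convergence theorem \<open>x L(x + A)\<close> and \<open>\<kappa>(x)\<close> agree up to constant factors: (i) is equivalent to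
  \<open>E \<kappa>(|X|) < \<infinity>\<close>, that is, to \<open>\<Sum> P(|X| > b(n)) < \<infinity>\<close>.

  Since \<open>b(n)/n\<close> increases to infinity, \<open>\<Sum>\<^sub>n min(x/b(n), 1)\<^sup>2 \<le> 3 \<kappa>(x)\<close> and \<open>n min(x/b(n), 1)\<close> is at most
  \<open>\<kappa>(x)\<close> and tends to \<open>0\<close>.  Hence \<open>E \<kappa>(|X|) < \<infinity>\<close> makes truncated means negligible, no centring is
  needed, and Chebyshev's inequality for the truncated positive and negative parts, which are
  pairwise negatively correlated, gives \<open>\<Sum> n\<^sup>-\<^sup>1 P(|X\<^sub>1| + \<dots> + |X\<^sub>n| > \<epsilon> b(n)) < \<infinity>\<close>.  Along powers of two
  such a series forces almost sure convergence to \<open>0\<close> for any sequence monotone in \<open>n\<close>.  Conversely, (iii)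
  or (ii) implies \<open>|X\<^sub>n| < b(n)\<close> eventually, and the converse Borel--Cantelli lemma for pairwise
  negatively correlated events returns \<open>\<Sum> P(|X| > b(n)) < \<infinity>\<close>.
\<close>

section \<open>Uniform convergence for slowly varying functions\<close>

text \<open>Dominated convergence for the indicators of the exceedance sets: each point eventually
  leaves them, and the indicator of the bounded interval is an integrable majorant.\<close>

lemma measure_exceedance_tendsto_0:
  fixes g :: "nat \<Rightarrow> real \<Rightarrow> real"
  assumes [measurable]: "\<And>n. g n \<in> borel_measurable borel"
    and lim: "\<And>v. v \<in> {a..b} \<Longrightarrow> (\<lambda>n. g n v) \<longlonglongrightarrow> 0" and e: "\<epsilon> > 0"
  shows "(\<lambda>n. measure lborel {v\<in>{a..b}. \<epsilon> \<le> \<bar>g n v\<bar>}) \<longlonglongrightarrow> 0"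
proof -
  let ?B = "\<lambda>n. {v\<in>{a..b}. \<epsilon> \<le> \<bar>g n v\<bar>}"
  have "(\<lambda>n. integral\<^sup>L lborel (indicat_real (?B n))) \<longlonglongrightarrow> integral\<^sup>L lborel (\<lambda>_::real. 0)"
  proof (rule integral_dominated_convergence[where w = "indicat_real {a..b}"])
    show "integrable lborel (indicat_real {a..b})"
      using emeasure_compact_finite[OF compact_Icc, of a b] by (simp add: integrable_indicator_iff)
    show "AE v in lborel. (\<lambda>n. indicat_real (?B n) v) \<longlonglongrightarrow> 0"
    proof (rule AE_I2)
      fix v
      show "(\<lambda>n. indicat_real (?B n) v) \<longlonglongrightarrow> 0"
      proof (cases "v \<in> {a..b}")
        case True
        have "eventually (\<lambda>n. \<bar>g n v\<bar> < \<epsilon>) sequentially"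
          using tendstoD[OF lim[OF True] e] by (simp add: dist_real_def)
        then have "eventually (\<lambda>n. indicat_real (?B n) v = 0) sequentially"
          by eventually_elim (auto simp: indicator_def)
        then show ?thesis by (rule tendsto_eventually)
      qed (auto simp: indicator_def)
    qed
  qed (auto simp: indicator_def)
  then show ?thesis by simp
qed

text \<open>If uniformity failed along \<open>x\<^sub>n + u\<^sub>n\<close>, the points \<open>v\<close> for which \<open>h (x\<^sub>n + v)\<close> is far from
  \<open>h x\<^sub>n\<close>, respectively from \<open>h (x\<^sub>n + u\<^sub>n)\<close>, would cover an interval of length \<open>K\<close>, although both
  sets have measure tending to \<open>0\<close>.\<close>

lemma additive_uniform_convergence:
  fixes h :: "real \<Rightarrow> real"
  assumes [measurable]: "h \<in> borel_measurable borel"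
    and lim: "\<And>u. ((\<lambda>x. h (x + u) - h x) \<longlongrightarrow> 0) at_top" and K: "K > 0" and e: "\<epsilon> > 0"
  shows "eventually (\<lambda>x. \<forall>u\<in>{0..K}. \<bar>h (x + u) - h x\<bar> < \<epsilon>) at_top"
proof (rule ccontr)
  assume "\<not> ?thesis"
  then have "\<forall>n::nat. \<exists>x u. x \<ge> real n \<and> u \<in> {0..K} \<and> \<epsilon> \<le> \<bar>h (x + u) - h x\<bar>"
    unfolding eventually_at_top_linorder by (meson not_le)
  then obtain x u where xu: "\<And>n::nat. x n \<ge> real n" "\<And>n::nat. u n \<in> {0..K}"
    "\<And>n::nat. \<epsilon> \<le> \<bar>h (x n + u n) - h (x n)\<bar>" by metis
  have x_lim: "filterlim x at_top sequentially"
    by (rule filterlim_at_top_mono[OF filterlim_real_sequentially]) (use xu in auto)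
  have xu_lim: "filterlim (\<lambda>n. x n + u n) at_top sequentially"
    by (rule filterlim_at_top_mono[OF x_lim]) (use xu in auto)
  define B where "B n = {v\<in>{0..2*K}. \<epsilon>/2 \<le> \<bar>h (x n + v) - h (x n)\<bar>}" for n
  define C where "C n = {v\<in>{0..2*K}. \<epsilon>/2 \<le> \<bar>h (x n + u n + v) - h (x n + u n)\<bar>}" for n
  have B: "(\<lambda>n. measure lborel (B n)) \<longlonglongrightarrow> 0" unfolding B_def
    by (rule measure_exceedance_tendsto_0) (use e filterlim_compose[OF lim x_lim] in auto)
  have C: "(\<lambda>n. measure lborel (C n)) \<longlonglongrightarrow> 0" unfolding C_def
    by (rule measure_exceedance_tendsto_0) (use e filterlim_compose[OF lim xu_lim] in auto)
  have "eventually (\<lambda>n. measure lborel (B n) < K/2 \<and> measure lborel (C n) < K/2) sequentially"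
    using order_tendstoD(2)[OF B, of "K/2"] order_tendstoD(2)[OF C, of "K/2"] K
    by (auto intro: eventually_conj)
  then obtain n where n: "measure lborel (B n) < K/2" "measure lborel (C n) < K/2"
    by (metis (mono_tags, lifting) eventually_sequentially order_refl)
  \<comment> \<open>\<open>C n\<close> records deviations from \<open>h (x n + u n)\<close>;
    translated by \<open>u n\<close>, it speaks about the same point \<open>x n + v\<close> as
    \<open>B n\<close>.\<close>
  define D where "D = {v. v - u n \<in> C n}"
  have [measurable]: "B n \<in> sets borel" "C n \<in> sets borel" unfolding B_def C_def by measurable
  have Dm[measurable]: "D \<in> sets borel" unfolding D_def by measurable
  have box: "{0..3*K} \<in> fmeasurable lborel"
    using emeasure_compact_finite[OF compact_Icc, of 0 "3*K"] by (simp add: fmeasurable_def)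
  have Bf: "B n \<in> fmeasurable lborel"
    by (rule fmeasurableI2[OF box]) (use K in \<open>auto simp: B_def\<close>)
  have Df: "D \<in> fmeasurable lborel"
    by (rule fmeasurableI2[OF box]) (use K xu(2)[of n] in \<open>auto simp: C_def D_def\<close>)
  have "emeasure lborel D = emeasure (distr lborel borel (\<lambda>v. u n + v)) D"
    using lborel_distr_plus[of "u n"] by simp
  also have "\<dots> = emeasure lborel (C n)"
    by (subst emeasure_distr) (auto simp: D_def vimage_def)
  finally have meas_D: "measure lborel D = measure lborel (C n)" by (simp add: measure_def)
  \<comment> \<open>For such \<open>v\<close> both \<open>v\<close> and \<open>v - u n\<close> lie
    in \<open>[0, 2 K]\<close>. If \<open>h (x n + v)\<close> were within \<epsilon>/2 of both
    \<open>h (x n)\<close> and \<open>h (x n + u n)\<close>, the triangle inequality would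
    contradict the choice of \<open>u n\<close>.\<close>
  have sub: "{K..2*K} \<subseteq> B n \<union> D"
  proof
    fix v assume v: "v \<in> {K..2*K}"
    show "v \<in> B n \<union> D"
    proof (rule ccontr)
      assume "\<not> ?thesis"
      then have "\<bar>h (x n + v) - h (x n)\<bar> < \<epsilon>/2" "\<bar>h (x n + v) - h (x n + u n)\<bar> < \<epsilon>/2"
        using v xu(2)[of n] K by (auto simp: B_def C_def D_def not_le)
      then show False using xu(3)[of n] by linarith
    qed
  qed
  have "measure lborel {K..2*K} \<le> measure lborel (B n \<union> D)"
    by (rule measure_mono_fmeasurable[OF sub _ fmeasurable.Un[OF Bf Df]]) simp
  also have "\<dots> \<le> measure lborel (B n) + measure lborel (C n)"
    using measure_Un_le[of "B n" lborel D] meas_D by simp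
  finally show False using n K by simp
qed

text \<open>The substitution \<open>h t = ln (L (exp t))\<close> turns slow variation into the
  additive form; the tolerance \<open>ln 2\<close> there is the factor \<open>2\<close> here.
  Uniformity in \<open>c\<close> matters because later \<open>c\<close> varies with the
  argument.\<close>

lemma slowly_varying_two_sided_bound:
  assumes L: "slowly_varying A L" and K: "K > 1"
  shows "eventually (\<lambda>x. \<forall>c\<in>{1..K}. L (c * x) \<le> 2 * L x \<and> L x \<le> 2 * L (c * x)) at_top"
proof -
  have A: "A > 0" and pos: "\<And>x. x \<ge> A \<Longrightarrow> L x > 0"
    and [measurable]: "L \<in> borel_measurable (restrict_space borel {A..})"
    and lim: "\<And>c. c > 0 \<Longrightarrow> ((\<lambda>x. L (c * x) / L x) \<longlongrightarrow> 1) at_top"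
    using L unfolding slowly_varying_def by blast+
  \<comment> \<open>The value \<open>1\<close> outside the domain makes \<open>h\<close> Borel
    measurable on the whole line and does not affect limits at infinity.\<close>
  define h where "h t = ln (if exp t \<in> {A..} then L (exp t) else 1)" for t
  have "(\<lambda>x. if x \<in> {A..} then L x else 1) \<in> borel_measurable borel"
    by (subst measurable_restrict_space_iff[symmetric]) auto
  then have "h \<in> borel_measurable borel" unfolding h_def
    using measurable_compose[of exp borel borel "\<lambda>x. if x \<in> {A..} then L x else 1" borel]
    by (intro borel_measurable_ln) auto
  moreover have "((\<lambda>x. h (x + u) - h x) \<longlongrightarrow> 0) at_top" for u
  proof -
    have "((\<lambda>t. L (exp u * exp t) / L (exp t)) \<longlongrightarrow> 1) at_top"
      using filterlim_compose[OF lim[of "exp u"] exp_at_top] by simp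
    then have "((\<lambda>t. ln (L (exp u * exp t) / L (exp t))) \<longlongrightarrow> ln 1) at_top"
      by (rule tendsto_ln) auto
    moreover have "eventually (\<lambda>t. t \<ge> ln A \<and> t + u \<ge> ln A) at_top"
      using eventually_ge_at_top[of "max (ln A) (ln A - u)"] by eventually_elim auto
    then have "eventually (\<lambda>t. h (t + u) - h t = ln (L (exp u * exp t) / L (exp t))) at_top"
    proof eventually_elim
      case (elim t)
      then have "exp t \<ge> A" "exp (t + u) \<ge> A" using A
        by (metis exp_le_cancel_iff exp_ln)+
      then show ?case using pos[of "exp t"] pos[of "exp (t + u)"]
        by (simp add: h_def ln_div exp_add mult.commute)
    qed
    ultimately show ?thesis by (simp add: tendsto_cong)
  qed
  ultimately have "eventually (\<lambda>t. \<forall>u\<in>{0..ln K}. \<bar>h (t + u) - h t\<bar> < ln 2) at_top"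
    by (rule additive_uniform_convergence) (use K in auto)
  then have "eventually (\<lambda>x. \<forall>u\<in>{0..ln K}. \<bar>h (ln x + u) - h (ln x)\<bar> < ln 2) at_top"
    using ln_at_top by (rule eventually_compose_filterlim)
  then show ?thesis using eventually_ge_at_top[of A]
  proof eventually_elim
    case (elim x)
    show ?case
    proof
      fix c assume c: "c \<in> {1..K}"
      have x: "x > 0" "A \<le> c * x" using A elim c
        by (auto intro: order_trans[OF _ mult_right_mono[of 1 c x]])
      have "\<bar>h (ln x + ln c) - h (ln x)\<bar> < ln 2" using elim(1) c by simp
      moreover have "h (ln x + ln c) = ln (L (c * x))"
        using x c by (simp add: h_def exp_add mult.commute)
      moreover have "h (ln x) = ln (L x)" using x elim(2) by (simp add: h_def)
      ultimately have "ln (L (c * x)) < ln 2 + ln (L x)" "ln (L x) < ln 2 + ln (L (c * x))"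
        by linarith+
      then have "ln (L (c * x)) < ln (2 * L x)" "ln (L x) < ln (2 * L (c * x))"
        using pos[OF elim(2)] pos[OF x(2)] by (simp_all add: ln_mult)
      then show "L (c * x) \<le> 2 * L x \<and> L x \<le> 2 * L (c * x)"
        using pos[OF elim(2)] pos[OF x(2)] by simp
    qed
  qed
qed

section \<open>Negative dependence and second moments\<close>

text \<open>Layer-cake form of Hoeffding's covariance identity: \<open>R \<omega>\<close> and \<open>Q \<omega>\<close> are sets of levels
  whose lengths are the two random variables.\<close>

lemma (in prob_space) nn_integral_mult_layers_le:
  fixes R Q :: "'a \<Rightarrow> real \<Rightarrow> bool"
  assumes [measurable]: "Measurable.pred (M \<Otimes>\<^sub>M lborel) (case_prod R)"
      "Measurable.pred (M \<Otimes>\<^sub>M lborel) (case_prod Q)"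
    and le: "\<And>s t. \<P>(\<omega> in M. R \<omega> s \<and> Q \<omega> t) \<le> \<P>(\<omega> in M. R \<omega> s) * \<P>(\<omega> in M. Q \<omega> t)"
  shows "(\<integral>\<^sup>+\<omega>. emeasure lborel {s. R \<omega> s} * emeasure lborel {t. Q \<omega> t} \<partial>M)
    \<le> (\<integral>\<^sup>+\<omega>. emeasure lborel {s. R \<omega> s} \<partial>M) * (\<integral>\<^sup>+\<omega>. emeasure lborel {t. Q \<omega> t} \<partial>M)"
proof -
  interpret P: pair_sigma_finite M lborel ..
  let ?i = "\<lambda>b::bool. if b then 1 else 0 :: ennreal"
  have lev: "emeasure lborel {s. H \<omega> s} = (\<integral>\<^sup>+s. ?i (H \<omega> s) \<partial>lborel)"
    if [measurable]: "Measurable.pred (M \<Otimes>\<^sub>M lborel) (case_prod H)" and w: "\<omega> \<in> space M" for H \<omega>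
  proof -
    have "Measurable.pred lborel (H \<omega>)"
      using measurable_Pair2[OF that(1) w] by simp
    from predE[OF this] have [measurable]: "{s. H \<omega> s} \<in> sets borel"
      unfolding space_lborel space_borel sets_lborel by (simp only: UNIV_I simp_thms)
    have "emeasure lborel {s. H \<omega> s} = (\<integral>\<^sup>+s. indicator {s. H \<omega> s} s \<partial>lborel)"
      by (rule nn_integral_indicator[symmetric]) simp
    then show ?thesis by (simp add: indicator_def of_bool_def)
  qed
  have prb: "(\<integral>\<^sup>+\<omega>. ?i (H \<omega>) \<partial>M) = ennreal (\<P>(\<omega> in M. H \<omega>))" if [measurable]: "Measurable.pred M H" for H
  proof -
    have "(\<integral>\<^sup>+\<omega>. ?i (H \<omega>) \<partial>M) = (\<integral>\<^sup>+\<omega>. indicator {\<omega>\<in>space M. H \<omega>} \<omega> \<partial>M)"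
      by (rule nn_integral_cong) (simp add: indicator_def of_bool_def)
    also have "\<dots> = emeasure M {\<omega>\<in>space M. H \<omega>}" by (rule nn_integral_indicator) measurable
    finally show ?thesis by (simp add: emeasure_eq_measure)
  qed
  have exch: "(\<integral>\<^sup>+\<omega>. (\<integral>\<^sup>+s. ?i (H \<omega> s) \<partial>lborel) \<partial>M) = (\<integral>\<^sup>+s. ennreal (\<P>(\<omega> in M. H \<omega> s)) \<partial>lborel)"
    if [measurable]: "Measurable.pred (M \<Otimes>\<^sub>M lborel) (case_prod H)" for H
    by (subst P.Fubini'[symmetric]) (auto intro!: nn_integral_cong prb)
  let ?r = "\<lambda>s. ennreal (\<P>(\<omega> in M. R \<omega> s))" and ?q = "\<lambda>s. ennreal (\<P>(\<omega> in M. Q \<omega> s))"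
  have [measurable]: "?r \<in> borel_measurable lborel" "?q \<in> borel_measurable lborel"
    by measurable
  have "(\<integral>\<^sup>+\<omega>. emeasure lborel {s. R \<omega> s} * emeasure lborel {t. Q \<omega> t} \<partial>M)
      = (\<integral>\<^sup>+\<omega>. (\<integral>\<^sup>+s. (\<integral>\<^sup>+t. ?i (R \<omega> s) * ?i (Q \<omega> t) \<partial>lborel) \<partial>lborel) \<partial>M)"
    by (rule nn_integral_cong) (simp add: lev nn_integral_cmult nn_integral_multc)
  also have "\<dots> = (\<integral>\<^sup>+s. (\<integral>\<^sup>+\<omega>. (\<integral>\<^sup>+t. ?i (R \<omega> s) * ?i (Q \<omega> t) \<partial>lborel) \<partial>M) \<partial>lborel)"
    by (subst P.Fubini') auto
  also have "\<dots> = (\<integral>\<^sup>+s. (\<integral>\<^sup>+t. (\<integral>\<^sup>+\<omega>. ?i (R \<omega> s) * ?i (Q \<omega> t) \<partial>M) \<partial>lborel) \<partial>lborel)"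
    by (intro nn_integral_cong, subst P.Fubini') auto
  also have "\<dots> = (\<integral>\<^sup>+s. (\<integral>\<^sup>+t. ennreal (\<P>(\<omega> in M. R \<omega> s \<and> Q \<omega> t)) \<partial>lborel) \<partial>lborel)"
    by (intro nn_integral_cong, subst prb[symmetric]) (auto intro!: nn_integral_cong)
  also have "\<dots> \<le> (\<integral>\<^sup>+s. (\<integral>\<^sup>+t. ?r s * ?q t \<partial>lborel) \<partial>lborel)"
    by (intro nn_integral_mono) (auto simp flip: ennreal_mult' intro!: ennreal_leI le)
  also have "\<dots> = (\<integral>\<^sup>+s. ?r s \<partial>lborel) * (\<integral>\<^sup>+t. ?q t \<partial>lborel)"
    by (simp add: nn_integral_cmult nn_integral_multc)
  also have "\<dots> = (\<integral>\<^sup>+\<omega>. emeasure lborel {s. R \<omega> s} \<partial>M) * (\<integral>\<^sup>+\<omega>. emeasure lborel {t. Q \<omega> t} \<partial>M)"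
    by (subst (1 2) exch[symmetric]) (auto simp: lev cong: nn_integral_cong)
  finally show ?thesis .
qed

text \<open>Both \<open>trunc_part c x\<close> and \<open>trunc_part c (- x)\<close> are monotone in
  \<open>x\<close>, unlike the absolute value, so negative dependence survives this truncation. For
  \<open>\<bar>x\<bar> \<le> c\<close> they add up to \<open>\<bar>x\<bar>\<close>.\<close>

definition trunc_part :: "real \<Rightarrow> real \<Rightarrow> real" where
  "trunc_part c x = min (max x 0) c"

lemma trunc_part_measurable [measurable]: "trunc_part c \<in> borel_measurable borel"
  unfolding trunc_part_def by measurable

lemma trunc_part_bounds: "0 \<le> c \<Longrightarrow> 0 \<le> trunc_part c x" "trunc_part c x \<le> c"
  by (auto simp: trunc_part_def)

text \<open>Passage from nonnegative integrals to expectations; the common bound \<open>c\<close>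
  supplies integrability.\<close>

lemma (in prob_space) expectation_mult_layers_le:
  fixes U V :: "'a \<Rightarrow> real" and R Q :: "'a \<Rightarrow> real \<Rightarrow> bool"
  assumes [measurable]: "random_variable borel U" "random_variable borel V"
    and U: "\<And>\<omega>. U \<omega> \<in> {0..c}" and V: "\<And>\<omega>. V \<omega> \<in> {0..c}"
    and R: "Measurable.pred (M \<Otimes>\<^sub>M lborel) (case_prod R)" "\<And>\<omega>. emeasure lborel {s. R \<omega> s} = ennreal (U \<omega>)"
    and Q: "Measurable.pred (M \<Otimes>\<^sub>M lborel) (case_prod Q)" "\<And>\<omega>. emeasure lborel {s. Q \<omega> s} = ennreal (V \<omega>)"
    and le: "\<And>s t. \<P>(\<omega> in M. R \<omega> s \<and> Q \<omega> t) \<le> \<P>(\<omega> in M. R \<omega> s) * \<P>(\<omega> in M. Q \<omega> t)"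
  shows "expectation (\<lambda>\<omega>. U \<omega> * V \<omega>) \<le> expectation U * expectation V"
proof -
  have iU: "integrable M U" using U by (intro integrable_const_bound[where B=c]) auto
  have iV: "integrable M V" using V by (intro integrable_const_bound[where B=c]) auto
  have iUV: "integrable M (\<lambda>\<omega>. U \<omega> * V \<omega>)" using U V
    by (intro integrable_const_bound[where B="c*c"]) (auto intro!: AE_I2 mult_mono order_trans[of 0 "U _" c] simp: abs_mult)
  have "ennreal (expectation (\<lambda>\<omega>. U \<omega> * V \<omega>)) = (\<integral>\<^sup>+\<omega>. ennreal (U \<omega>) * ennreal (V \<omega>) \<partial>M)"
    using iUV U V by (simp add: nn_integral_eq_integral[symmetric] ennreal_mult)
  also have "\<dots> \<le> (\<integral>\<^sup>+\<omega>. ennreal (U \<omega>) \<partial>M) * (\<integral>\<^sup>+\<omega>. ennreal (V \<omega>) \<partial>M)"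
    using nn_integral_mult_layers_le[OF R(1) Q(1) le] by (simp add: R(2) Q(2))
  also have "\<dots> = ennreal (expectation U * expectation V)"
    using iU iV U V by (simp add: nn_integral_eq_integral ennreal_mult integral_nonneg)
  finally show ?thesis using U V by (simp add: integral_nonneg)
qed

text \<open>With lower-tail probabilities \<open>p\<close>, \<open>q\<close> and joint lower tail
  \<open>r\<close>, inclusion-exclusion gives \<open>1 - p - q + r\<close> on the left and
  \<open>(1 - p) (1 - q)\<close> on the right, so both inequalities say
  \<open>r \<le> p q\<close>.\<close>

lemma (in prob_space) neg_dependent_upper:
  fixes X Y :: "'a \<Rightarrow> real"
  assumes [measurable]: "random_variable borel X" "random_variable borel Y"
    and nd: "\<P>(\<omega> in M. X \<omega> \<le> x \<and> Y \<omega> \<le> y) \<le> \<P>(\<omega> in M. X \<omega> \<le> x) * \<P>(\<omega> in M. Y \<omega> \<le> y)"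
  shows "\<P>(\<omega> in M. X \<omega> > x \<and> Y \<omega> > y) \<le> \<P>(\<omega> in M. X \<omega> > x) * \<P>(\<omega> in M. Y \<omega> > y)"
proof -
  have Xc: "\<P>(\<omega> in M. X \<omega> > x) = 1 - \<P>(\<omega> in M. X \<omega> \<le> x)"
    using prob_neg[of "\<lambda>\<omega>. X \<omega> \<le> x"] by (simp add: not_le)
  have Yc: "\<P>(\<omega> in M. Y \<omega> > y) = 1 - \<P>(\<omega> in M. Y \<omega> \<le> y)"
    using prob_neg[of "\<lambda>\<omega>. Y \<omega> \<le> y"] by (simp add: not_le)
  have "\<P>(\<omega> in M. X \<omega> > x \<and> Y \<omega> > y) = 1 - prob ({\<omega>\<in>space M. X \<omega> \<le> x} \<union> {\<omega>\<in>space M. Y \<omega> \<le> y})"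
    by (subst prob_compl[symmetric]) (auto intro!: arg_cong[where f=prob])
  also have "prob ({\<omega>\<in>space M. X \<omega> \<le> x} \<union> {\<omega>\<in>space M. Y \<omega> \<le> y}) = \<P>(\<omega> in M. X \<omega> \<le> x) + \<P>(\<omega> in M. Y \<omega> \<le> y)
      - prob ({\<omega>\<in>space M. X \<omega> \<le> x} \<inter> {\<omega>\<in>space M. Y \<omega> \<le> y})"
    using measure_Un3[of "{\<omega>\<in>space M. X \<omega> \<le> x}" M "{\<omega>\<in>space M. Y \<omega> \<le> y}"]
    by (simp add: fmeasurable_eq_sets)
  also have "{\<omega>\<in>space M. X \<omega> \<le> x} \<inter> {\<omega>\<in>space M. Y \<omega> \<le> y} = {\<omega>\<in>space M. X \<omega> \<le> x \<and> Y \<omega> \<le> y}"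
    by auto
  finally show ?thesis using nd unfolding Xc Yc by (simp add: algebra_simps)
qed

text \<open>A truncated part is the length of a set of levels given by one-sided tail events: upper
  tails for the positive part, lower tails for the negative part. Hoeffding's identity then needs
  negative dependence of these events only.\<close>

lemma (in prob_space) neg_dependent_trunc_part:
  fixes X Y :: "'a \<Rightarrow> real"
  assumes [measurable]: "random_variable borel X" "random_variable borel Y"
    and nd: "\<And>x y. \<P>(\<omega> in M. X \<omega> \<le> x \<and> Y \<omega> \<le> y) \<le> \<P>(\<omega> in M. X \<omega> \<le> x) * \<P>(\<omega> in M. Y \<omega> \<le> y)"
    and c: "0 \<le> c"
  shows "expectation (\<lambda>\<omega>. trunc_part c (X \<omega>) * trunc_part c (Y \<omega>))
      \<le> expectation (\<lambda>\<omega>. trunc_part c (X \<omega>)) * expectation (\<lambda>\<omega>. trunc_part c (Y \<omega>))" (is ?pos)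
    and "expectation (\<lambda>\<omega>. trunc_part c (- X \<omega>) * trunc_part c (- Y \<omega>))
      \<le> expectation (\<lambda>\<omega>. trunc_part c (- X \<omega>)) * expectation (\<lambda>\<omega>. trunc_part c (- Y \<omega>))" (is ?neg)
proof -
  let ?R = "\<lambda>Z \<omega> s. 0 \<le> s \<and> s < c \<and> s < (Z \<omega> :: real)"
  have lenR: "emeasure lborel {s. ?R Z \<omega> s} = ennreal (trunc_part c (Z \<omega>))" for Z :: "'a \<Rightarrow> real" and \<omega>
  proof -
    have "{s. ?R Z \<omega> s} = {0..<trunc_part c (Z \<omega>)}" by (auto simp: trunc_part_def)
    then show ?thesis using c by (simp add: trunc_part_bounds)
  qed
  have mR: "Measurable.pred (M \<Otimes>\<^sub>M lborel) (case_prod (?R Z))" if [measurable]: "Z \<in> borel_measurable M" for Z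
    by measurable
  \<comment> \<open>Levels outside \<open>[0, c)\<close> give impossible events, and then both sides
    vanish.\<close>
  have leR: "\<P>(\<omega> in M. ?R X \<omega> s \<and> ?R Y \<omega> t) \<le> \<P>(\<omega> in M. ?R X \<omega> s) * \<P>(\<omega> in M. ?R Y \<omega> t)" for s t
    using neg_dependent_upper[OF assms(1,2) nd, of s t]
    by (cases "0 \<le> s \<and> s < c"; cases "0 \<le> t \<and> t < c") auto
  show ?pos
    by (rule expectation_mult_layers_le[where R = "?R X" and Q = "?R Y" and c = c
          and U = "\<lambda>\<omega>. trunc_part c (X \<omega>)" and V = "\<lambda>\<omega>. trunc_part c (Y \<omega>)",
          OF _ _ _ _ mR[OF assms(1)] lenR[of X] mR[OF assms(2)] lenR[of Y] leR])
       (use c in \<open>simp_all add: trunc_part_bounds\<close>)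
  \<comment> \<open>The non-strict tail fits the definition of negative dependence directly; closing
    the level interval at its end leaves its length unchanged.\<close>
  let ?Q = "\<lambda>Z \<omega> s. 0 \<le> s \<and> s < c \<and> (Z \<omega> :: real) \<le> - s"
  have lenQ: "emeasure lborel {s. ?Q Z \<omega> s} = ennreal (trunc_part c (- Z \<omega>))" for Z :: "'a \<Rightarrow> real" and \<omega>
  proof -
    consider "Z \<omega> > 0" | "Z \<omega> \<le> 0" "- Z \<omega> < c" | "c \<le> - Z \<omega>" by linarith
    then show ?thesis
    proof cases
      case 1
      then have "{s. ?Q Z \<omega> s} = {}" "trunc_part c (- Z \<omega>) = 0" using c by (auto simp: trunc_part_def)
      then show ?thesis by (metis emeasure_empty ennreal_0)
    next
      case 2
      then have "{s. ?Q Z \<omega> s} = {0..- Z \<omega>}" "trunc_part c (- Z \<omega>) = - Z \<omega>"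
        by (auto simp: trunc_part_def)
      then show ?thesis using 2 by simp
    next
      case 3
      then have "{s. ?Q Z \<omega> s} = {0..<c}" "trunc_part c (- Z \<omega>) = c"
        using c by (auto simp: trunc_part_def)
      then show ?thesis using c by simp
    qed
  qed
  have mQ: "Measurable.pred (M \<Otimes>\<^sub>M lborel) (case_prod (?Q Z))" if [measurable]: "Z \<in> borel_measurable M" for Z
    by measurable
  have leQ: "\<P>(\<omega> in M. ?Q X \<omega> s \<and> ?Q Y \<omega> t) \<le> \<P>(\<omega> in M. ?Q X \<omega> s) * \<P>(\<omega> in M. ?Q Y \<omega> t)" for s t
    using nd[of "- s" "- t"]
    by (cases "0 \<le> s \<and> s < c"; cases "0 \<le> t \<and> t < c") auto
  show ?neg
    by (rule expectation_mult_layers_le[where R = "?Q X" and Q = "?Q Y" and c = c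
          and U = "\<lambda>\<omega>. trunc_part c (- X \<omega>)" and V = "\<lambda>\<omega>. trunc_part c (- Y \<omega>)",
          OF _ _ _ _ mQ[OF assms(1)] lenQ[of X] mQ[OF assms(2)] lenQ[of Y] leQ])
       (use c in \<open>simp_all add: trunc_part_bounds\<close>)
qed

text \<open>In the expanded square, negative correlation bounds the off-diagonal terms by products
  of means, which the squared mean absorbs; the second moments on the diagonal remain.\<close>

lemma (in prob_space) variance_sum_le_of_neg_correlated:
  fixes U :: "'i \<Rightarrow> 'a \<Rightarrow> real"
  assumes "finite I" and [measurable]: "\<And>i. i \<in> I \<Longrightarrow> random_variable borel (U i)"
    and bd: "\<And>i \<omega>. i \<in> I \<Longrightarrow> \<bar>U i \<omega>\<bar> \<le> c"
    and nc: "\<And>i j. i \<in> I \<Longrightarrow> j \<in> I \<Longrightarrow> i \<noteq> j \<Longrightarrow>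
        expectation (\<lambda>\<omega>. U i \<omega> * U j \<omega>) \<le> expectation (U i) * expectation (U j)"
  shows "variance (\<lambda>\<omega>. \<Sum>i\<in>I. U i \<omega>) \<le> (\<Sum>i\<in>I. expectation (\<lambda>\<omega>. (U i \<omega>)\<^sup>2))"
proof -
  have i1: "integrable M (U i)" if "i \<in> I" for i
    using that bd by (intro integrable_const_bound[where B=c]) auto
  have i2: "integrable M (\<lambda>\<omega>. U i \<omega> * U j \<omega>)" if "i \<in> I" "j \<in> I" for i j
    using that bd[of i] bd[of j]
    by (intro integrable_const_bound[where B="c*c"])
       (auto intro!: AE_I2 mult_mono order_trans[OF abs_ge_zero] simp: abs_mult)
  have sq: "(\<Sum>i\<in>I. U i \<omega>)\<^sup>2 = (\<Sum>i\<in>I. \<Sum>j\<in>I. U i \<omega> * U j \<omega>)" for \<omega>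
    by (simp add: power2_eq_square sum_product)
  have iS: "integrable M (\<lambda>\<omega>. \<Sum>i\<in>I. U i \<omega>)" using i1 by auto
  have iS2: "integrable M (\<lambda>\<omega>. (\<Sum>i\<in>I. U i \<omega>)\<^sup>2)" unfolding sq using i2 by auto
  have "expectation (\<lambda>\<omega>. (\<Sum>i\<in>I. U i \<omega>)\<^sup>2) = (\<Sum>i\<in>I. \<Sum>j\<in>I. expectation (\<lambda>\<omega>. U i \<omega> * U j \<omega>))"
    unfolding sq using i2 by simp
  \<comment> \<open>The diagonal also receives its product of means, a nonnegative square, so that
    the double sum factors completely.\<close>
  also have "\<dots> \<le> (\<Sum>i\<in>I. \<Sum>j\<in>I. expectation (U i) * expectation (U j)
      + (if i = j then expectation (\<lambda>\<omega>. (U i \<omega>)\<^sup>2) else 0))"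
    using nc by (intro sum_mono) (auto simp: power2_eq_square)
  also have "\<dots> = (\<Sum>i\<in>I. expectation (U i))\<^sup>2 + (\<Sum>i\<in>I. expectation (\<lambda>\<omega>. (U i \<omega>)\<^sup>2))"
    using \<open>finite I\<close> by (simp add: sum.distrib power2_eq_square sum_product)
  also have "(\<Sum>i\<in>I. expectation (U i)) = expectation (\<lambda>\<omega>. \<Sum>i\<in>I. U i \<omega>)"
    using i1 by simp
  finally show ?thesis by (simp add: variance_eq[OF iS iS2])
qed

text \<open>Chebyshev without centring: once the mean is at most \<open>a\<close>, exceeding
  \<open>2 * a\<close> forces a deviation of at least \<open>a\<close> from the mean.\<close>

lemma (in prob_space) prob_sum_neg_correlated_le:
  fixes U :: "'i \<Rightarrow> 'a \<Rightarrow> real"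
  assumes "finite I" and [measurable]: "\<And>i. i \<in> I \<Longrightarrow> random_variable borel (U i)"
    and bd: "\<And>i \<omega>. i \<in> I \<Longrightarrow> \<bar>U i \<omega>\<bar> \<le> c"
    and nc: "\<And>i j. i \<in> I \<Longrightarrow> j \<in> I \<Longrightarrow> i \<noteq> j \<Longrightarrow>
        expectation (\<lambda>\<omega>. U i \<omega> * U j \<omega>) \<le> expectation (U i) * expectation (U j)"
    and a: "(\<Sum>i\<in>I. expectation (U i)) \<le> a" "a > 0"
    and v: "(\<Sum>i\<in>I. expectation (\<lambda>\<omega>. (U i \<omega>)\<^sup>2)) \<le> v"
  shows "\<P>(\<omega> in M. (\<Sum>i\<in>I. U i \<omega>) > 2 * a) \<le> v / a\<^sup>2"
proof -
  let ?S = "\<lambda>\<omega>. \<Sum>i\<in>I. U i \<omega>"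
  have "integrable M (U i)" if "i \<in> I" for i
    using that bd by (intro integrable_const_bound[where B=c]) auto
  then have "expectation ?S \<le> a" using a by simp
  have "\<bar>?S \<omega>\<bar> \<le> card I * c" for \<omega>
    by (rule order_trans[OF sum_abs]) (use sum_bounded_above[of I "\<lambda>i. \<bar>U i \<omega>\<bar>" c] bd in auto)
  then have "integrable M (\<lambda>\<omega>. (?S \<omega>)\<^sup>2)"
    by (intro integrable_const_bound[where B="(card I * c)\<^sup>2"])
       (auto intro!: AE_I2 power2_le_iff_abs_le[THEN iffD2] order_trans[OF abs_ge_zero])
  then have "prob {\<omega>\<in>space M. \<bar>?S \<omega> - expectation ?S\<bar> \<ge> a} \<le> variance ?S / a\<^sup>2"
    using a by (intro Chebyshev_inequality) auto
  moreover have "\<P>(\<omega> in M. ?S \<omega> > 2 * a) \<le> prob {\<omega>\<in>space M. \<bar>?S \<omega> - expectation ?S\<bar> \<ge> a}"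
    using \<open>expectation ?S \<le> a\<close> by (intro finite_measure_mono) auto
  moreover have "variance ?S \<le> v"
    using variance_sum_le_of_neg_correlated[where U = U and c = c, OF assms(1,2) bd nc] v by linarith
  then have "variance ?S / a\<^sup>2 \<le> v / a\<^sup>2" by (intro divide_right_mono) auto
  ultimately show ?thesis by linarith
qed

section \<open>Almost sure convergence\<close>

text \<open>The converse Borel--Cantelli lemma.  If the probabilities had infinite sum, the number
  \<open>S n\<close> of events among the first \<open>n\<close>, of mean \<open>m n\<close>, would be almost surely bounded, so
  \<open>S n / m n - 1 \<rightarrow> -1\<close>; this contradicts Fatou's lemma, as its second moment is at most
  \<open>1 / m n\<close>.\<close>

lemma (in prob_space) summable_prob_of_neg_correlated:
  assumes [measurable]: "\<And>n. A n \<in> events"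
    and nc: "\<And>i j::nat. i \<noteq> j \<Longrightarrow> prob (A i \<inter> A j) \<le> prob (A i) * prob (A j)"
    and ev: "AE \<omega> in M. eventually (\<lambda>n. \<omega> \<notin> A n) sequentially"
  shows "summable (\<lambda>n. prob (A n))"
proof (rule ccontr)
  assume not_summable: "\<not> ?thesis"
  define m where "m n = (\<Sum>i<n. prob (A i))" for n
  define S where "S n \<omega> = (\<Sum>i<n. indicat_real (A i) \<omega>)" for n \<omega>
  define f where "f n \<omega> = ennreal (((S n \<omega> - m n) / m n)\<^sup>2)" for n \<omega>
  have [measurable]: "S n \<in> borel_measurable M" for n unfolding S_def by measurable
  have [measurable]: "f n \<in> borel_measurable M" for n unfolding f_def by measurable
  have m_lim: "filterlim m at_top sequentially"
    unfolding filterlim_at_top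
  proof
    fix Z :: real
    obtain n where n: "Z < m n"
      using not_summable summableI_nonneg_bounded[of "\<lambda>n. prob (A n)" Z] measure_nonneg
      unfolding m_def by (meson not_le)
    have "m n \<le> m k" if "n \<le> k" for k
      unfolding m_def using that by (intro sum_mono2) auto
    then show "eventually (\<lambda>n. Z \<le> m n) sequentially"
      using n by (force simp: eventually_sequentially)
  qed
  then have m_pos: "eventually (\<lambda>n. 0 < m n) sequentially" by (simp add: filterlim_at_top_dense)
  have ES: "expectation (S n) = m n" for n
    unfolding S_def m_def by (subst Bochner_Integration.integral_sum) (auto simp: integrable_indicator_iff emeasure_eq_measure)
  have S_bd: "\<bar>S n \<omega>\<bar> \<le> n" for n \<omega>
    unfolding S_def using sum_bounded_above[of "{..<n}" "\<lambda>i. indicat_real (A i) \<omega>" 1]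
    by (auto simp: sum_nonneg indicator_def)
  have var: "variance (S n) \<le> m n" for n
  proof -
    have "variance (S n) \<le> (\<Sum>i\<in>{..<n}. expectation (\<lambda>\<omega>. (indicat_real (A i) \<omega>)\<^sup>2))"
      unfolding S_def
    proof (rule variance_sum_le_of_neg_correlated[where c=1])
      show "\<bar>indicat_real (A i) \<omega>\<bar> \<le> 1" for i \<omega> by (simp add: indicator_def)
      show "expectation (\<lambda>\<omega>. indicat_real (A i) \<omega> * indicat_real (A j) \<omega>)
          \<le> expectation (indicat_real (A i)) * expectation (indicat_real (A j))" if "i \<noteq> j" for i j
        using nc[OF that] by (simp flip: indicator_inter_arith)
    qed auto
    also have "\<dots> = m n" by (auto simp: m_def power2_eq_square simp flip: indicator_inter_arith)
    finally show ?thesis .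
  qed
  have int_f: "(\<integral>\<^sup>+\<omega>. f n \<omega> \<partial>M) \<le> ennreal (1 / m n)" if "m n > 0" for n
  proof -
    have "integrable M (\<lambda>\<omega>. (S n \<omega> - m n)\<^sup>2)"
    proof (rule integrable_const_bound[where B="(real n + m n)\<^sup>2"])
      have "\<bar>S n \<omega> - m n\<bar> \<le> real n + m n" for \<omega> using S_bd[of n \<omega>] that by linarith
      then show "AE \<omega> in M. norm ((S n \<omega> - m n)\<^sup>2) \<le> (real n + m n)\<^sup>2"
        using that by (auto intro!: AE_I2 power2_le_iff_abs_le[THEN iffD2])
    qed auto
    then have "(\<integral>\<^sup>+\<omega>. f n \<omega> \<partial>M) = ennreal (variance (S n) / (m n)\<^sup>2)"
      unfolding f_def by (subst nn_integral_eq_integral) (auto simp: power_divide ES)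
    also have "\<dots> \<le> ennreal (m n / (m n)\<^sup>2)"
      using var by (intro ennreal_leI divide_right_mono) auto
    finally show ?thesis using that by (simp add: power2_eq_square)
  qed
  have "AE \<omega> in M. (\<lambda>n. f n \<omega>) \<longlonglongrightarrow> 1"
    using ev
  proof eventually_elim
    fix \<omega> assume "eventually (\<lambda>n. \<omega> \<notin> A n) sequentially"
    then obtain k where k: "\<And>n. n \<ge> k \<Longrightarrow> \<omega> \<notin> A n" by (auto simp: eventually_sequentially)
    \<comment> \<open>Once no further event occurs, the count is frozen while \<open>m n\<close>
      grows.\<close>
    have Sk: "S n \<omega> = S k \<omega>" if "n \<ge> k" for n
      unfolding S_def using that k by (intro sum.mono_neutral_right) auto
    have "eventually (\<lambda>n. ennreal ((S k \<omega> / m n - 1)\<^sup>2) = f n \<omega>) sequentially"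
      using m_pos eventually_ge_at_top[of k]
    proof eventually_elim
      case (elim n)
      then show ?case using Sk[of n] by (simp add: f_def diff_divide_distrib)
    qed
    moreover have "(\<lambda>n. S k \<omega> / m n) \<longlonglongrightarrow> 0"
      by (intro real_tendsto_divide_at_top[OF tendsto_const m_lim])
    then have "(\<lambda>n. ennreal ((S k \<omega> / m n - 1)\<^sup>2)) \<longlonglongrightarrow> ennreal ((0 - 1)\<^sup>2)"
      by (intro tendsto_intros)
    ultimately have "(\<lambda>n. f n \<omega>) \<longlonglongrightarrow> ennreal ((0 - 1)\<^sup>2)"
      by (rule Lim_transform_eventually[rotated])
    then show "(\<lambda>n. f n \<omega>) \<longlonglongrightarrow> 1" by simp
  qed
  then have "AE \<omega> in M. liminf (\<lambda>n. f n \<omega>) = 1"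
    by eventually_elim (rule lim_imp_Liminf, simp_all)
  then have "(\<integral>\<^sup>+\<omega>. liminf (\<lambda>n. f n \<omega>) \<partial>M) = (\<integral>\<^sup>+\<omega>. 1 \<partial>M)"
    by (rule nn_integral_cong_AE)
  then have "1 \<le> liminf (\<lambda>n. \<integral>\<^sup>+\<omega>. f n \<omega> \<partial>M)"
    using nn_integral_liminf[of f M] by (simp add: emeasure_space_1)
  moreover have "(\<lambda>n. \<integral>\<^sup>+\<omega>. f n \<omega> \<partial>M) \<longlonglongrightarrow> 0"
  proof (rule tendsto_sandwich[OF _ _ tendsto_const])
    have "(\<lambda>n. 1 / m n) \<longlonglongrightarrow> 0" by (intro real_tendsto_divide_at_top[OF tendsto_const m_lim])
    then show "(\<lambda>n. ennreal (1 / m n)) \<longlonglongrightarrow> 0" using tendsto_ennrealI by fastforce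
    show "eventually (\<lambda>n. (\<integral>\<^sup>+\<omega>. f n \<omega> \<partial>M) \<le> ennreal (1 / m n)) sequentially"
      using m_pos by eventually_elim (rule int_f)
  qed auto
  then have "liminf (\<lambda>n. \<integral>\<^sup>+\<omega>. f n \<omega> \<partial>M) = 0" by (intro lim_imp_Liminf) auto
  ultimately show False by simp
qed

lemma sum_dyadic_blocks:
  fixes f :: "nat \<Rightarrow> 'a::comm_monoid_add"
  shows "(\<Sum>k<K. \<Sum>n\<in>{2^k..<2^Suc k}. f n) = (\<Sum>n\<in>{1..<2^K}. f n)"
proof (induction K)
  case (Suc K)
  have "(\<Sum>n\<in>{1..<2^K}. f n) + (\<Sum>n\<in>{2^K..<2^Suc K}. f n) = (\<Sum>n\<in>{1..<2^Suc K}. f n)"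
    by (rule sum.atLeastLessThan_concat) auto
  then show ?case by (simp only: sum.lessThan_Suc Suc)
qed auto

text \<open>The weight \<open>1 / n\<close> gives each dyadic block total mass at least
  \<open>1/2\<close>, and by monotonicity one event at scale \<open>2^k\<close> implies all events
  of its block. Borel--Cantelli then applies along powers of two, and \<open>growth\<close> fills
  the gaps.\<close>

lemma (in prob_space) AE_tendsto_0_of_summable_prob:
  fixes S :: "nat \<Rightarrow> 'a \<Rightarrow> real" and b :: "nat \<Rightarrow> real"
  assumes "\<And>n. n \<ge> 1 \<Longrightarrow> random_variable borel (S n)"
    and S_mono: "\<And>n k \<omega>. 1 \<le> n \<Longrightarrow> n \<le> k \<Longrightarrow> S n \<omega> \<le> S k \<omega>"
    and S_nonneg: "\<And>n \<omega>. 1 \<le> n \<Longrightarrow> 0 \<le> S n \<omega>"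
    and b_mono: "\<And>n k. m \<le> n \<Longrightarrow> n \<le> k \<Longrightarrow> b n \<le> b k" and b_pos: "b m > 0"
    and growth: "eventually (\<lambda>n. b (4 * n) \<le> C * b n) sequentially" and C: "C > 0"
    and summ: "\<And>\<epsilon>. \<epsilon> > 0 \<Longrightarrow> summable (\<lambda>n. 1 / real n * \<P>(\<omega> in M. S n \<omega> > \<epsilon> * b n))"
  shows "AE \<omega> in M. (\<lambda>n. S n \<omega> / b n) \<longlonglongrightarrow> 0"
proof -
  have dyadic: "AE \<omega> in M. eventually (\<lambda>k. S (2^k) \<omega> \<le> \<epsilon> * b (2^Suc k)) sequentially" if e: "\<epsilon> > 0" for \<epsilon>
  proof -
    define f where "f n = 1 / real n * \<P>(\<omega> in M. S n \<omega> > \<epsilon> * b n)" for n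
    \<comment> \<open>The process is taken at the left end of the block and the threshold at the
      right end, so that \<open>E k\<close> lies inside every event of the block.\<close>
    define E where "E k = {\<omega>\<in>space M. S (2^k) \<omega> > \<epsilon> * b (2^Suc k)}" for k
    have [measurable]: "E k \<in> events" for k
    proof -
      have [measurable]: "random_variable borel (S (2^k))" by (rule assms(1)) simp
      show ?thesis unfolding E_def by measurable
    qed
    have f0: "f n \<ge> 0" for n by (simp add: f_def)
    have "summable f" using summ[OF e] by (simp add: f_def[abs_def])
    then have "(\<Sum>n\<in>{1..<2^K}. f n) \<le> suminf f" for K
      using f0 by (intro sum_le_suminf) auto
    then have "summable (\<lambda>k. \<Sum>n\<in>{2^k..<2^Suc k}. f n)"
      using f0 by (intro summableI_nonneg_bounded[where x = "suminf f"])
        (auto simp only: sum_dyadic_blocks intro!: sum_nonneg)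
    then have "summable (\<lambda>k. 2 * (\<Sum>n\<in>{2^k..<2^Suc k}. f n))" by (rule summable_mult)
    then have "summable (\<lambda>k. prob (E k))"
    proof (rule summable_comparison_test'[where N = m])
      fix k assume k: "k \<ge> m"
      \<comment> \<open>This puts the whole block into the range where \<open>b\<close> is
        monotone.\<close>
      have "m < 2^k" using k less_exp[of k] by linarith
      have "(\<Sum>n\<in>{2^k..<2^Suc k::nat}. prob (E k) / 2^Suc k) \<le> (\<Sum>n\<in>{2^k..<2^Suc k}. f n)"
      proof (rule sum_mono)
        fix n assume n: "n \<in> {2^k..<2^Suc k::nat}"
        then have n1: "n \<ge> 1" using one_le_power[of "2::nat" k] by (auto simp del: one_le_power)
        have "prob (E k) \<le> \<P>(\<omega> in M. S n \<omega> > \<epsilon> * b n)"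
        proof (rule finite_measure_mono)
          have "b n \<le> b (2^Suc k)" using n \<open>m < 2^k\<close> by (intro b_mono) auto
          then have "\<epsilon> * b n \<le> \<epsilon> * b (2^Suc k)" using e by simp
          moreover have "S (2^k) \<omega> \<le> S n \<omega>" for \<omega> using n by (intro S_mono) auto
          ultimately show "E k \<subseteq> {\<omega>\<in>space M. S n \<omega> > \<epsilon> * b n}"
            unfolding E_def by (blast intro: le_less_trans less_le_trans)
          have [measurable]: "random_variable borel (S n)" using n1 by (rule assms(1))
          show "{\<omega>\<in>space M. S n \<omega> > \<epsilon> * b n} \<in> events" by measurable
        qed
        moreover have "real n \<le> 2^Suc k" using n of_nat_mono[of n "2^Suc k", where 'a=real] by auto
        ultimately show "prob (E k) / 2^Suc k \<le> f n"
          unfolding f_def using n1 frac_le[of "\<P>(\<omega> in M. S n \<omega> > \<epsilon> * b n)" "prob (E k)" "real n" "2^Suc k"] by simp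
      qed
      moreover have "(\<Sum>n\<in>{2^k..<2^Suc k::nat}. prob (E k) / 2^Suc k) = prob (E k) / 2" by simp
      ultimately show "norm (prob (E k)) \<le> 2 * (\<Sum>n\<in>{2^k..<2^Suc k}. f n)" by simp
    qed
    then have "AE \<omega> in M. eventually (\<lambda>k. \<omega> \<in> space M - E k) sequentially"
      by (intro borel_cantelli_AE1) (auto simp: emeasure_eq_measure)
    then show ?thesis
      by eventually_elim (auto simp: E_def not_less elim!: eventually_mono)
  qed
  \<comment> \<open>Countably many tolerances suffice, so the exceptional null sets combine into
    one.\<close>
  have "AE \<omega> in M. \<forall>j::nat. eventually (\<lambda>k. S (2^k) \<omega> \<le> 1 / real (Suc j) * b (2^Suc k)) sequentially"
    unfolding AE_all_countable
  proof
    show "AE \<omega> in M. eventually (\<lambda>k. S (2^k) \<omega> \<le> 1 / real (Suc j) * b (2^Suc k)) sequentially" for j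
      by (rule dyadic) simp
  qed
  then show ?thesis
  proof eventually_elim
    fix \<omega> assume all: "\<forall>j::nat. eventually (\<lambda>k. S (2^k) \<omega> \<le> 1 / real (Suc j) * b (2^Suc k)) sequentially"
    show "(\<lambda>n. S n \<omega> / b n) \<longlonglongrightarrow> 0"
    proof (rule LIMSEQ_I)
      fix r :: real assume r: "r > 0"
      \<comment> \<open>Dividing by \<open>C\<close> in advance pays for replacing
        \<open>b (4 * n)\<close> by \<open>b n\<close>.\<close>
      obtain j where j: "1 / real (Suc j) < r / C"
        using reals_Archimedean[of "r / C"] r C by (auto simp: inverse_eq_divide)
      obtain K where K: "\<And>k. k \<ge> K \<Longrightarrow> S (2^k) \<omega> \<le> 1 / real (Suc j) * b (2^Suc k)"
        using all by (auto simp: eventually_sequentially)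
      obtain N where N: "\<And>n. n \<ge> N \<Longrightarrow> b (4 * n) \<le> C * b n"
        using growth by (auto simp: eventually_sequentially)
      show "\<exists>n0. \<forall>n\<ge>n0. norm (S n \<omega> / b n - 0) < r"
      proof (intro exI allI impI)
        fix n assume n: "n \<ge> max (max m N) (2^K)"
        have "1 \<le> n" using n le_trans[of 1 "2^K" n] by simp
        then obtain k where k: "2^k \<le> n" "n < 2^(k + 1)" using ex_power_ivl1[of 2 n] by auto
        have bn: "b n > 0" using b_mono[of m n] b_pos n by auto
        have "(2::nat)^K < 2^(k+1)" using k n by auto
        then have "K \<le> Suc k" using power_less_imp_less_exp[of "2::nat" K "k + 1"] by simp
        \<comment> \<open>Rounding \<open>n\<close> up to \<open>2^(k+1)\<close> and passing to the
          right end of that block doubles twice, and \<open>2^(k+2) \<le> 4 * n\<close>: the origin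
          of the \<open>4\<close> in \<open>growth\<close>.\<close>
        have "S n \<omega> \<le> S (2^Suc k) \<omega>" using k \<open>1 \<le> n\<close> by (intro S_mono) auto
        also have "\<dots> \<le> 1 / real (Suc j) * b (2^Suc (Suc k))" using K \<open>K \<le> Suc k\<close> by blast
        also have "\<dots> \<le> 1 / real (Suc j) * b (4 * n)"
        proof (rule mult_left_mono)
          have "m \<le> 2^Suc (Suc k)" using n k by auto
          then show "b (2^Suc (Suc k)) \<le> b (4 * n)" using k by (intro b_mono) auto
        qed simp
        also have "\<dots> \<le> 1 / real (Suc j) * (C * b n)" using N n by (intro mult_left_mono) auto
        also have "\<dots> < r / C * (C * b n)" using j C bn by (intro mult_strict_right_mono) auto
        also have "\<dots> = r * b n" using C by simp
        finally show "norm (S n \<omega> / b n - 0) < r"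
          using bn S_nonneg[OF \<open>1 \<le> n\<close>, of \<omega>] by (simp add: divide_simps)
      qed
    qed
  qed
qed

section \<open>Norming sequences\<close>

text \<open>\<open>l\<close> abstracts \<open>Lt\<close> at the integers, and \<open>m\<close> the
  first positive integer in its domain. Monotone \<open>l\<close> means that \<open>b n / n\<close>
  is nondecreasing, the property behind the truncation estimates.\<close>

locale norming =
  fixes l :: "nat \<Rightarrow> real" and m :: nat
  assumes m_pos: "1 \<le> m" and l_mono: "\<And>i j. m \<le> i \<Longrightarrow> i \<le> j \<Longrightarrow> l i \<le> l j"
    and l_pos: "0 < l m" and l_lim: "filterlim l at_top sequentially"
begin

definition b :: "nat \<Rightarrow> real" where "b n = real n * l n"

text \<open>The generalized inverse of \<open>b\<close>. The search starts at \<open>m\<close>,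
  where monotonicity of \<open>b\<close> begins; hence the constant \<open>m\<close> in
  \<open>kappa_suminf\<close>.\<close>

definition kappa :: "real \<Rightarrow> nat" where "kappa x = (LEAST n. m \<le> n \<and> x \<le> b n)"

lemma l_pos': "m \<le> n \<Longrightarrow> 0 < l n"
  using l_mono[of m n] l_pos by simp

lemma b_mono: "m \<le> i \<Longrightarrow> i \<le> j \<Longrightarrow> b i \<le> b j"
  unfolding b_def using l_pos'[of i] by (intro mult_mono l_mono) auto

lemma b_pos: "m \<le> n \<Longrightarrow> 0 < b n"
  unfolding b_def using l_pos' m_pos by simp

lemma b_lim: "filterlim b at_top sequentially"
  unfolding b_def by (rule filterlim_at_top_mult_at_top[OF filterlim_real_sequentially l_lim])

lemma kappa_props: "m \<le> kappa x" "x \<le> b (kappa x)"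
proof -
  have "eventually (\<lambda>n. m \<le> n \<and> x \<le> b n) sequentially"
    using b_lim eventually_ge_at_top by (intro eventually_conj) (auto simp: filterlim_at_top)
  then obtain n where "m \<le> n \<and> x \<le> b n" by (auto simp: eventually_sequentially)
  from LeastI[of "\<lambda>n. m \<le> n \<and> x \<le> b n", OF this]
  show "m \<le> kappa x" "x \<le> b (kappa x)" by (auto simp: kappa_def)
qed

lemma less_kappa_iff: "m \<le> n \<Longrightarrow> n < kappa x \<longleftrightarrow> b n < x"
  using not_less_Least[of n "\<lambda>n. m \<le> n \<and> x \<le> b n"] kappa_props[of x] b_mono[of "kappa x" n]
  by (fastforce simp: kappa_def not_less)

lemma kappa_mono: "x \<le> y \<Longrightarrow> kappa x \<le> kappa y"
  using kappa_props[of y] less_kappa_iff[of "kappa y" x] by (meson leI le_less_trans not_le)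

lemma kappa_measurable [measurable]: "(\<lambda>x. real (kappa x)) \<in> borel_measurable borel"
  by (rule borel_measurable_mono) (auto simp: mono_def kappa_mono)

text \<open>The indices \<open>n \<ge> m\<close> with \<open>b n < x\<close> are exactly those below
  \<open>kappa x\<close>. Integrated termwise, this count turns the mean of \<open>kappa\<close>
  into a series of tail probabilities.\<close>

lemma kappa_suminf:
  "ennreal (real (kappa x)) = ennreal (real m) + (\<Sum>n. if m \<le> n \<and> b n < x then 1 else 0)"
proof -
  have "(\<Sum>n. if m \<le> n \<and> b n < x then 1 else 0 :: ennreal) = (\<Sum>n\<in>{m..<kappa x}. if m \<le> n \<and> b n < x then 1 else 0)"
    by (rule suminf_finite) (auto simp: less_kappa_iff[symmetric])
  also have "\<dots> = (\<Sum>n\<in>{m..<kappa x}. 1)"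
    by (intro sum.cong) (auto simp: less_kappa_iff)
  also have "\<dots> = ennreal (real (kappa x - m))"
    by (simp add: ennreal_of_nat_eq_real_of_nat)
  finally show ?thesis using kappa_props(1)[of x] by (simp flip: ennreal_plus)
qed

text \<open>With \<open>k = kappa x\<close> one has \<open>x \<le> b k\<close> and
  \<open>b k / b n = (k / n) (l k / l n)\<close>, where the last factor is at most
  \<open>1\<close>.\<close>

lemma ratio_le: "0 \<le> x \<Longrightarrow> kappa x \<le> n \<Longrightarrow> x / b n \<le> kappa x / n"
proof -
  assume x: "0 \<le> x" and n: "kappa x \<le> n"
  have k: "m \<le> kappa x" "x \<le> b (kappa x)" by (rule kappa_props)+
  have "x * n \<le> kappa x * l (kappa x) * n" using k by (intro mult_right_mono) (auto simp: b_def)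
  also have "\<dots> \<le> kappa x * l n * n"
    using l_mono[of "kappa x" n] k n by (intro mult_right_mono mult_left_mono) auto
  finally have "x * n \<le> kappa x * b n" by (simp add: b_def mult_ac)
  moreover have "b n > 0" "n > 0" using b_pos[of n] k n m_pos by auto
  ultimately show ?thesis by (simp add: field_simps)
qed

text \<open>Below \<open>kappa x\<close> the factor \<open>n\<close> is already small enough; from
  there on \<open>ratio_le\<close> cancels it. The bound is free of \<open>n\<close> and later
  serves as integrable majorant.\<close>

lemma truncated_ratio_le:
  assumes "0 \<le> x" "m \<le> n" shows "n * min (x / b n) 1 \<le> kappa x"
proof (cases "n < kappa x")
  case True
  have "n * min (x / b n) 1 \<le> real n * 1" by (intro mult_left_mono) auto
  then show ?thesis using True by linarith
next
  case False
  have n: "n > 0" using assms m_pos by simp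
  have "n * min (x / b n) 1 \<le> n * (kappa x / n)"
    using ratio_le[of x n] assms False by (intro mult_left_mono) auto
  then show ?thesis using n by simp
qed

text \<open>The potential \<open>D\<close> grows by at least the summand in each step and stays below \<open>3 \<kappa>(x)\<close>.\<close>

lemma sum_truncated_ratio_sq_le:
  assumes x: "0 \<le> x"
  shows "(\<Sum>i<N. (min (x / b (i + m)) 1)\<^sup>2) \<le> 3 * kappa x"
proof -
  define k where "k = real (kappa x)"
  \<comment> \<open>Up to \<open>k\<close> a summand costs at most \<open>1\<close>; beyond, the
    terms \<open>k^2 / n^2\<close> are bounded by differences of \<open>2 k^2 / n\<close>. The
    constant \<open>3 * k\<close> makes both branches equal \<open>k\<close> at
    \<open>n = k\<close>.\<close>
  define D where "D n = (if n \<le> kappa x then real n else 3 * k - 2 * k\<^sup>2 / n)" for n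
  have km: "real m \<le> k" "k \<ge> 1" using kappa_props(1)[of x] m_pos by (auto simp: k_def)
  have step: "(min (x / b n) 1)\<^sup>2 \<le> D (Suc n) - D n" if n: "m \<le> n" for n
  proof (cases "n < kappa x")
    case True
    have "0 \<le> x / b n" using x b_pos[OF n] by simp
    then have "(min (x / b n) 1)\<^sup>2 \<le> 1\<^sup>2" by (intro power_mono) auto
    then show ?thesis using True by (simp add: D_def)
  next
    case False
    have n0: "real n \<ge> 1" using n m_pos by simp
    have "0 \<le> x / b n" "x / b n \<le> k / n"
      using x b_pos[OF n] ratio_le[of x n] False by (auto simp: k_def)
    then have "(min (x / b n) 1)\<^sup>2 \<le> (k / n)\<^sup>2" by (intro power_mono) auto
    also have "\<dots> \<le> 2 * k\<^sup>2 / n - 2 * k\<^sup>2 / Suc n"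
    proof -
      have "2 * k\<^sup>2 / n - 2 * k\<^sup>2 / Suc n = k\<^sup>2 * (2 / (n * Suc n))"
        using n0 by (simp add: field_simps)
      moreover have "1 / (real n)\<^sup>2 \<le> 2 / (n * Suc n)"
      proof -
        have "real n * Suc n \<le> 2 * (real n)\<^sup>2"
          using mult_left_mono[OF n0, of "real n"] by (simp add: power2_eq_square algebra_simps)
        then have "2 / (2 * (real n)\<^sup>2) \<le> 2 / (real n * Suc n)"
          using n0 by (intro divide_left_mono) auto
        then show ?thesis by (simp add: algebra_simps)
      qed
      then have "k\<^sup>2 * (1 / (real n)\<^sup>2) \<le> k\<^sup>2 * (2 / (n * Suc n))" by (rule mult_left_mono) simp
      ultimately show ?thesis by (simp add: power_divide)
    qed
    also have "\<dots> = D (Suc n) - D n"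
      using False km by (cases "n = kappa x") (auto simp: D_def k_def power2_eq_square)
    finally show ?thesis .
  qed
  have "(\<Sum>i<N. (min (x / b (i + m)) 1)\<^sup>2) \<le> D (N + m)"
  proof (induction N)
    case (Suc N)
    then show ?case using step[of "N + m"] by simp
  qed (use kappa_props(1)[of x] in \<open>simp add: D_def\<close>)
  also have "\<dots> \<le> 3 * k" using km by (auto simp: D_def k_def)
  finally show ?thesis by (simp add: k_def)
qed

text \<open>Integrating \<open>kappa_suminf\<close> at \<open>\<bar>x\<bar>\<close> expresses the
  integral as \<open>m\<close> plus the series of tails.\<close>

lemma kappa_integrable_of_summable_tails:
  assumes "prob_space D" and [measurable_cong]: "sets D = sets borel"
    and summ: "summable (\<lambda>n. measure D {x. b (n + m) < \<bar>x\<bar>})"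
  shows "(\<integral>\<^sup>+x. ennreal (kappa \<bar>x\<bar>) \<partial>D) < \<infinity>"
proof -
  interpret D: prob_space D by fact
  have spD: "space D = UNIV" using sets_eq_imp_space_eq[OF assms(2)] by simp
  have "summable (\<lambda>n. if m \<le> n then measure D {x. b n < \<bar>x\<bar>} else 0)"
    by (rule summable_iff_shift[THEN iffD1, of _ m]) (use summ in simp)
  then have fin: "(\<Sum>n. ennreal (if m \<le> n then measure D {x. b n < \<bar>x\<bar>} else 0)) < \<infinity>"
    by (subst suminf_ennreal2) auto
  have tail: "(\<integral>\<^sup>+x. (if m \<le> n \<and> b n < \<bar>x\<bar> then 1 else 0) \<partial>D)
      = ennreal (if m \<le> n then measure D {x. b n < \<bar>x\<bar>} else 0)" for n
  proof (cases "m \<le> n")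
    case True
    have [measurable]: "{x. b n < \<bar>x\<bar>} \<in> sets D" by measurable
    have "(\<integral>\<^sup>+x. (if m \<le> n \<and> b n < \<bar>x\<bar> then 1 else 0) \<partial>D) = (\<integral>\<^sup>+x. indicator {x. b n < \<bar>x\<bar>} x \<partial>D)"
      using True by (intro nn_integral_cong) (auto simp: indicator_def)
    then show ?thesis using True by (simp add: D.emeasure_eq_measure)
  qed simp
  have "(\<integral>\<^sup>+x. ennreal (kappa \<bar>x\<bar>) \<partial>D)
      = (\<integral>\<^sup>+x. ennreal (real m) \<partial>D) + (\<Sum>n. \<integral>\<^sup>+x. (if m \<le> n \<and> b n < \<bar>x\<bar> then 1 else 0) \<partial>D)"
    unfolding kappa_suminf by (subst nn_integral_add) (auto simp: nn_integral_suminf)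
  then show ?thesis using fin unfolding tail by (simp add: D.emeasure_space_1)
qed

text \<open>For the second moments, sum and integral are exchanged and the pointwise bound
  \<open>3 * kappa\<close> is integrated. For the means, dominated convergence applies with majorant
  \<open>kappa\<close>, since \<open>\<bar>x\<bar> / l n\<close> tends to \<open>0\<close>
  pointwise.\<close>

lemma
  assumes "prob_space D" and [measurable_cong]: "sets D = sets borel"
    and fin: "(\<integral>\<^sup>+x. ennreal (kappa \<bar>x\<bar>) \<partial>D) < \<infinity>"
  shows summable_truncated_second_moments:
      "summable (\<lambda>n. \<integral>x. (min (\<bar>x\<bar> / b n) 1)\<^sup>2 \<partial>D)"
    and truncated_means_tendsto_0:
      "(\<lambda>n. real n * (\<integral>x. min (\<bar>x\<bar> / b n) 1 \<partial>D)) \<longlonglongrightarrow> 0"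
proof -
  interpret D: prob_space D by fact
  have int_k: "integrable D (\<lambda>x. real (kappa \<bar>x\<bar>))"
    using fin by (intro integrableI_nonneg) auto
  \<comment> \<open>Indices are shifted by \<open>m\<close>, since below it the sign of
    \<open>b\<close> is not controlled.\<close>
  have bd: "\<bar>min (\<bar>x\<bar> / b (i + m)) 1\<bar> \<le> 1" for x i
  proof -
    have "0 \<le> \<bar>x\<bar> / b (i + m)" using b_pos[of "i + m"] by simp
    then show ?thesis by (simp add: abs_if min_def)
  qed
  have int_sq: "integrable D (\<lambda>x. (min (\<bar>x\<bar> / b (i + m)) 1)\<^sup>2)" for i
    using bd by (intro D.integrable_const_bound[where B=1]) (auto simp: abs_square_le_1)
  have "summable (\<lambda>i. \<integral>x. (min (\<bar>x\<bar> / b (i + m)) 1)\<^sup>2 \<partial>D)"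
  proof (rule summableI_nonneg_bounded)
    fix N
    have "(\<Sum>i<N. \<integral>x. (min (\<bar>x\<bar> / b (i + m)) 1)\<^sup>2 \<partial>D) = (\<integral>x. (\<Sum>i<N. (min (\<bar>x\<bar> / b (i + m)) 1)\<^sup>2) \<partial>D)"
      using int_sq by simp
    also have "\<dots> \<le> (\<integral>x. 3 * real (kappa \<bar>x\<bar>) \<partial>D)"
      using int_sq int_k sum_truncated_ratio_sq_le by (intro integral_mono) auto
    finally show "(\<Sum>i<N. \<integral>x. (min (\<bar>x\<bar> / b (i + m)) 1)\<^sup>2 \<partial>D) \<le> (\<integral>x. 3 * real (kappa \<bar>x\<bar>) \<partial>D)" .
  qed (auto intro: integral_nonneg)
  then show "summable (\<lambda>n. \<integral>x. (min (\<bar>x\<bar> / b n) 1)\<^sup>2 \<partial>D)" by (rule summable_iff_shift[THEN iffD1])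
  have "(\<lambda>i. \<integral>x. real (i + m) * min (\<bar>x\<bar> / b (i + m)) 1 \<partial>D) \<longlonglongrightarrow> (\<integral>x. 0 \<partial>D)"
  proof (rule integral_dominated_convergence[where w = "\<lambda>x. real (kappa \<bar>x\<bar>)"])
    show "AE x in D. norm (real (i + m) * min (\<bar>x\<bar> / b (i + m)) 1) \<le> real (kappa \<bar>x\<bar>)" for i
    proof (rule AE_I2)
      fix x
      have "0 \<le> min (\<bar>x\<bar> / b (i + m)) 1" using b_pos[of "i + m"] by simp
      then show "norm (real (i + m) * min (\<bar>x\<bar> / b (i + m)) 1) \<le> real (kappa \<bar>x\<bar>)"
        using truncated_ratio_le[of "\<bar>x\<bar>" "i + m"] by (simp add: abs_mult)
    qed
    show "AE x in D. (\<lambda>i. real (i + m) * min (\<bar>x\<bar> / b (i + m)) 1) \<longlonglongrightarrow> 0"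
    proof (rule AE_I2)
      fix x
      have "(\<lambda>n. \<bar>x\<bar> / l n) \<longlonglongrightarrow> 0"
        by (rule real_tendsto_divide_at_top[OF tendsto_const l_lim])
      then have "(\<lambda>i. \<bar>x\<bar> / l (i + m)) \<longlonglongrightarrow> 0" by (rule LIMSEQ_ignore_initial_segment)
      then show "(\<lambda>i. real (i + m) * min (\<bar>x\<bar> / b (i + m)) 1) \<longlonglongrightarrow> 0"
      proof (rule tendsto_sandwich[OF _ _ tendsto_const, rotated 2])
        have "real (i + m) * min (\<bar>x\<bar> / b (i + m)) 1 \<le> real (i + m) * (\<bar>x\<bar> / b (i + m))" for i
          by (intro mult_left_mono) auto
        moreover have "real (i + m) * (\<bar>x\<bar> / b (i + m)) = \<bar>x\<bar> / l (i + m)" for i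
          using m_pos by (simp add: b_def)
        ultimately show "eventually (\<lambda>i. real (i + m) * min (\<bar>x\<bar> / b (i + m)) 1 \<le> \<bar>x\<bar> / l (i + m)) sequentially"
          by simp
        show "eventually (\<lambda>i. 0 \<le> real (i + m) * min (\<bar>x\<bar> / b (i + m)) 1) sequentially"
          using b_pos by (intro always_eventually) (auto intro!: mult_nonneg_nonneg simp: less_imp_le)
      qed
    qed
  qed (use int_k in auto)
  then have "(\<lambda>i. real (i + m) * (\<integral>x. min (\<bar>x\<bar> / b (i + m)) 1 \<partial>D)) \<longlonglongrightarrow> 0" by simp
  then show "(\<lambda>n. real n * (\<integral>x. min (\<bar>x\<bar> / b n) 1 \<partial>D)) \<longlonglongrightarrow> 0"
    by (rule LIMSEQ_offset[where k = m])
qed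

end

section \<open>Moments, tails and deviations\<close>

text \<open>Truncation at \<open>b n\<close>: either some variable exceeds \<open>b n\<close>, or
  the truncated positive or negative parts sum to more than half of \<open>\<epsilon> * b n\<close>.
  Each probability is at most a constant times \<open>n\<close> times a truncated second moment, and
  the weight \<open>1 / n\<close> cancels the factor \<open>n\<close>.\<close>

lemma (in norming) summable_deviation_probs:
  fixes X :: "nat \<Rightarrow> 'a \<Rightarrow> real"
  assumes "prob_space M" and X: "pairwise_neg_dependent M X {1..}"
    and D: "\<And>n. n \<ge> 1 \<Longrightarrow> distr M borel (X n) = D"
    and fin: "(\<integral>\<^sup>+x. ennreal (kappa \<bar>x\<bar>) \<partial>D) < \<infinity>" and e: "\<epsilon> > 0"
  shows "summable (\<lambda>n. 1 / real n * \<P>(\<omega> in M. (\<Sum>i=1..n. \<bar>X i \<omega>\<bar>) > \<epsilon> * b n))"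
proof -
  interpret prob_space M by fact
  have Xm: "random_variable borel (X i)" if "i \<ge> 1" for i
    using X that by (auto simp: pairwise_neg_dependent_def)
  have "prob_space D" using D[of 1] prob_space_distr[OF Xm[of 1]] by simp
  then interpret D: prob_space D .
  have sD[measurable_cong]: "sets D = sets borel" using D[of 1] by auto
  have ED: "expectation (\<lambda>\<omega>. g (X i \<omega>)) = (\<integral>x. g x \<partial>D)" if "i \<ge> 1" "g \<in> borel_measurable borel" for g :: "real \<Rightarrow> real" and i
    using integral_distr[OF Xm[OF that(1)] that(2)] D[OF that(1)] by simp
  define w where "w n = (\<integral>x. (min (\<bar>x\<bar> / b n) 1)\<^sup>2 \<partial>D)" for n
  have w_summable: "summable w"
    unfolding w_def by (rule summable_truncated_second_moments) (use fin sD \<open>prob_space D\<close> in auto)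
  have means: "(\<lambda>n. real n * (\<integral>x. min (\<bar>x\<bar> / b n) 1 \<partial>D)) \<longlonglongrightarrow> 0"
    by (rule truncated_means_tendsto_0) (use fin sD \<open>prob_space D\<close> in auto)
  \<comment> \<open>The \<open>1\<close> comes from single large values; each of the two signs
    contributes \<open>16 / \<epsilon>^2\<close> by Chebyshev at
    \<open>\<epsilon> * c / 4\<close>.\<close>
  have bound: "\<P>(\<omega> in M. (\<Sum>i=1..n. \<bar>X i \<omega>\<bar>) > \<epsilon> * b n) \<le> n * ((1 + 32 / \<epsilon>\<^sup>2) * w n)"
    if n: "m \<le> n" and small: "real n * (\<integral>x. min (\<bar>x\<bar> / b n) 1 \<partial>D) < \<epsilon> / 4" for n
  proof -
    define c where "c = b n"
    have c: "c > 0" using b_pos[OF n] by (simp add: c_def)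
    have ratio: "0 \<le> min (\<bar>x\<bar> / c) 1" "min (\<bar>x\<bar> / c) 1 \<le> 1" for x using c by auto
    have int1: "integrable D (\<lambda>x. min (\<bar>x\<bar> / c) 1)"
      using ratio by (intro D.integrable_const_bound[where B=1]) auto
    have int2: "integrable D (\<lambda>x. (min (\<bar>x\<bar> / c) 1)\<^sup>2)"
      using ratio by (intro D.integrable_const_bound[where B=1]) (auto simp: abs_square_le_1)
    \<comment> \<open>The sign \<sigma> selects positive or negative parts. \<open>small\<close>
      keeps the mean below \<open>\<epsilon> * c / 4\<close>, and twice that is half of the
      level.\<close>
    have part: "\<P>(\<omega> in M. (\<Sum>i=1..n. trunc_part c (\<sigma> * X i \<omega>)) > 2 * (\<epsilon> * c / 4)) \<le> n * (c\<^sup>2 * w n) / (\<epsilon> * c / 4)\<^sup>2"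
      if \<sigma>: "\<sigma> = 1 \<or> \<sigma> = -1" for \<sigma> :: real
    proof (rule prob_sum_neg_correlated_le[where c = c])
      have t1: "trunc_part c (\<sigma> * x) \<le> c * min (\<bar>x\<bar> / c) 1" for x
        using \<sigma> c by (auto simp: trunc_part_def min_mult_distrib_left abs_if)
      have t0: "0 \<le> trunc_part c (\<sigma> * x)" for x using c by (simp add: trunc_part_bounds)
      have t2: "(trunc_part c (\<sigma> * x))\<^sup>2 \<le> c\<^sup>2 * (min (\<bar>x\<bar> / c) 1)\<^sup>2" for x
        using power_mono[OF t1 t0, of x 2] by (simp add: power_mult_distrib)
      show "random_variable borel (\<lambda>\<omega>. trunc_part c (\<sigma> * X i \<omega>))" if "i \<in> {1..n}" for i
      proof -
        have [measurable]: "random_variable borel (X i)" using that by (intro Xm) auto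
        show ?thesis by measurable
      qed
      show "\<bar>trunc_part c (\<sigma> * X i \<omega>)\<bar> \<le> c" for i \<omega> using t0 by (simp add: trunc_part_bounds)
      show "expectation (\<lambda>\<omega>. trunc_part c (\<sigma> * X i \<omega>) * trunc_part c (\<sigma> * X j \<omega>))
          \<le> expectation (\<lambda>\<omega>. trunc_part c (\<sigma> * X i \<omega>)) * expectation (\<lambda>\<omega>. trunc_part c (\<sigma> * X j \<omega>))"
        if "i \<in> {1..n}" "j \<in> {1..n}" "i \<noteq> j" for i j
      proof -
        have "\<P>(\<omega> in M. X i \<omega> \<le> x \<and> X j \<omega> \<le> y) \<le> \<P>(\<omega> in M. X i \<omega> \<le> x) * \<P>(\<omega> in M. X j \<omega> \<le> y)" for x y
          using X that by (auto simp: pairwise_neg_dependent_def)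
        from neg_dependent_trunc_part[OF Xm Xm this, of c] that \<sigma> c show ?thesis by auto
      qed
      have m1: "expectation (\<lambda>\<omega>. trunc_part c (\<sigma> * X i \<omega>)) \<le> c * (\<integral>x. min (\<bar>x\<bar> / c) 1 \<partial>D)" if "i \<in> {1..n}" for i
      proof -
        have "integrable D (\<lambda>x. trunc_part c (\<sigma> * x))"
          using t0 by (intro D.integrable_const_bound[where B=c]) (auto simp: trunc_part_bounds)
        then have "(\<integral>x. trunc_part c (\<sigma> * x) \<partial>D) \<le> (\<integral>x. c * min (\<bar>x\<bar> / c) 1 \<partial>D)"
          using t1 int1 by (intro integral_mono) auto
        then show ?thesis using that by (subst ED) auto
      qed
      have "(\<Sum>i=1..n. expectation (\<lambda>\<omega>. trunc_part c (\<sigma> * X i \<omega>))) \<le> (\<Sum>i=1..n. c * (\<integral>x. min (\<bar>x\<bar> / c) 1 \<partial>D))"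
        by (intro sum_mono m1) auto
      also have "\<dots> = c * (n * (\<integral>x. min (\<bar>x\<bar> / c) 1 \<partial>D))" by simp
      also have "\<dots> \<le> c * (\<epsilon> / 4)" using small c by (intro mult_left_mono) (auto simp: c_def)
      finally show "(\<Sum>i=1..n. expectation (\<lambda>\<omega>. trunc_part c (\<sigma> * X i \<omega>))) \<le> \<epsilon> * c / 4"
        by (simp add: mult.commute)
      have m2: "expectation (\<lambda>\<omega>. (trunc_part c (\<sigma> * X i \<omega>))\<^sup>2) \<le> c\<^sup>2 * w n" if "i \<in> {1..n}" for i
      proof -
        have "integrable D (\<lambda>x. (trunc_part c (\<sigma> * x))\<^sup>2)"
          using t0 by (intro D.integrable_const_bound[where B="c\<^sup>2"]) (auto intro!: power_mono simp: trunc_part_bounds)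
        then have "(\<integral>x. (trunc_part c (\<sigma> * x))\<^sup>2 \<partial>D) \<le> (\<integral>x. c\<^sup>2 * (min (\<bar>x\<bar> / c) 1)\<^sup>2 \<partial>D)"
          using t2 int2 by (intro integral_mono) auto
        also have "\<dots> = c\<^sup>2 * w n" by (simp add: w_def c_def)
        finally show ?thesis using that by (subst ED) auto
      qed
      have "(\<Sum>i=1..n. expectation (\<lambda>\<omega>. (trunc_part c (\<sigma> * X i \<omega>))\<^sup>2)) \<le> (\<Sum>i=1..n. c\<^sup>2 * w n)"
        by (intro sum_mono m2) auto
      then show "(\<Sum>i=1..n. expectation (\<lambda>\<omega>. (trunc_part c (\<sigma> * X i \<omega>))\<^sup>2)) \<le> n * (c\<^sup>2 * w n)" by simp
      show "0 < \<epsilon> * c / 4" using e c by simp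
    qed simp
    have big: "\<P>(\<omega> in M. \<bar>X i \<omega>\<bar> > c) \<le> w n" if "i \<in> {1..n}" for i
    proof -
      have [measurable]: "random_variable borel (X i)" using that by (intro Xm) auto
      have "\<P>(\<omega> in M. \<bar>X i \<omega>\<bar> > c) = expectation (\<lambda>\<omega>. indicat_real {x. \<bar>x\<bar> > c} (X i \<omega>))"
      proof -
        have "\<P>(\<omega> in M. \<bar>X i \<omega>\<bar> > c) = expectation (indicat_real {\<omega>\<in>space M. \<bar>X i \<omega>\<bar> > c})"
          by (subst Bochner_Integration.integral_indicator) (auto intro!: arg_cong[where f=prob])
        also have "\<dots> = expectation (\<lambda>\<omega>. indicat_real {x. \<bar>x\<bar> > c} (X i \<omega>))"
          by (rule Bochner_Integration.integral_cong) (auto simp: indicator_def)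
        finally show ?thesis .
      qed
      also have "\<dots> = (\<integral>x. indicat_real {x. \<bar>x\<bar> > c} x \<partial>D)"
        using that by (intro ED) auto
      \<comment> \<open>Where \<open>\<bar>x\<bar> > c\<close> the truncated ratio is
        \<open>1\<close>, so its square dominates the indicator.\<close>
      also have "\<dots> \<le> (\<integral>x. (min (\<bar>x\<bar> / c) 1)\<^sup>2 \<partial>D)"
      proof (rule integral_mono[OF _ int2])
        show "integrable D (indicat_real {x. c < \<bar>x\<bar>})"
          by (simp add: integrable_indicator_iff D.emeasure_eq_measure)
        show "indicat_real {x. c < \<bar>x\<bar>} x \<le> (min (\<bar>x\<bar> / c) 1)\<^sup>2" for x
          using c by (auto simp: indicator_def min_def)
      qed
      finally show ?thesis by (simp add: w_def c_def)
    qed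
    let ?B = "\<Union>i\<in>{1..n}. {\<omega>\<in>space M. \<bar>X i \<omega>\<bar> > c}"
    let ?P = "\<lambda>\<sigma>. {\<omega>\<in>space M. (\<Sum>i=1..n. trunc_part c (\<sigma> * X i \<omega>)) > 2 * (\<epsilon> * c / 4)}"
    have Bm: "?B \<in> events"
      using Xm by (intro sets.finite_UN) auto
    have Pm: "?P \<sigma> \<in> events" for \<sigma>
    proof -
      have [measurable]: "random_variable borel (X i)" if "i \<in> {1..n}" for i using that by (intro Xm) auto
      show ?thesis by measurable
    qed
    have "{\<omega>\<in>space M. (\<Sum>i=1..n. \<bar>X i \<omega>\<bar>) > \<epsilon> * b n} \<subseteq> ?B \<union> (?P 1 \<union> ?P (-1))"
    proof
      fix \<omega> assume \<omega>: "\<omega> \<in> {\<omega>\<in>space M. (\<Sum>i=1..n. \<bar>X i \<omega>\<bar>) > \<epsilon> * b n}"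
      show "\<omega> \<in> ?B \<union> (?P 1 \<union> ?P (-1))"
      proof (cases "\<forall>i\<in>{1..n}. \<bar>X i \<omega>\<bar> \<le> c")
        case True
        have "\<bar>X i \<omega>\<bar> = trunc_part c (1 * X i \<omega>) + trunc_part c (-1 * X i \<omega>)" if "i \<in> {1..n}" for i
          using True that by (force simp: trunc_part_def abs_if)
        then have "(\<Sum>i=1..n. \<bar>X i \<omega>\<bar>) = (\<Sum>i=1..n. trunc_part c (1 * X i \<omega>)) + (\<Sum>i=1..n. trunc_part c (-1 * X i \<omega>))"
          unfolding sum.distrib[symmetric] by (intro sum.cong refl)
        moreover have "\<epsilon> * c < (\<Sum>i=1..n. \<bar>X i \<omega>\<bar>)" using \<omega> by (simp add: c_def)
        moreover have "2 * (\<epsilon> * c / 4) = \<epsilon> * c / 2" by simp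
        ultimately have "2 * (\<epsilon> * c / 4) < (\<Sum>i=1..n. trunc_part c (1 * X i \<omega>)) \<or> 2 * (\<epsilon> * c / 4) < (\<Sum>i=1..n. trunc_part c (-1 * X i \<omega>))"
          by linarith
        then show ?thesis using \<omega> by blast
      next
        case False
        then show ?thesis using \<omega> by (auto simp: not_le)
      qed
    qed
    then have "\<P>(\<omega> in M. (\<Sum>i=1..n. \<bar>X i \<omega>\<bar>) > \<epsilon> * b n) \<le> prob (?B \<union> (?P 1 \<union> ?P (-1)))"
      by (rule finite_measure_mono) (intro sets.Un Bm Pm)
    also have "\<dots> \<le> prob ?B + prob (?P 1 \<union> ?P (-1))" by (intro measure_Un_le sets.Un Bm Pm)
    also have "\<dots> \<le> prob ?B + (prob (?P 1) + prob (?P (-1)))"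
      by (intro add_left_mono measure_Un_le Pm)
    also have "prob ?B \<le> (\<Sum>i=1..n. \<P>(\<omega> in M. \<bar>X i \<omega>\<bar> > c))"
      using Xm by (intro finite_measure_subadditive_finite) auto
    also have "\<dots> \<le> (\<Sum>i=1..n. w n)" by (intro sum_mono big)
    also have "prob (?P 1) + prob (?P (-1)) \<le> n * (c\<^sup>2 * w n) / (\<epsilon> * c / 4)\<^sup>2 + n * (c\<^sup>2 * w n) / (\<epsilon> * c / 4)\<^sup>2"
      by (intro add_mono part) auto
    also have "(\<Sum>i=1..n. w n) + (n * (c\<^sup>2 * w n) / (\<epsilon> * c / 4)\<^sup>2 + n * (c\<^sup>2 * w n) / (\<epsilon> * c / 4)\<^sup>2)
        = n * ((1 + 32 / \<epsilon>\<^sup>2) * w n)"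
      using c e by (simp add: field_simps power2_eq_square)
    finally show ?thesis by simp
  qed
  have "eventually (\<lambda>n. real n * (\<integral>x. min (\<bar>x\<bar> / b n) 1 \<partial>D) < \<epsilon> / 4) sequentially"
    using order_tendstoD(2)[OF means, of "\<epsilon> / 4"] e by simp
  then have "eventually (\<lambda>n. norm (1 / real n * \<P>(\<omega> in M. (\<Sum>i=1..n. \<bar>X i \<omega>\<bar>) > \<epsilon> * b n)) \<le> (1 + 32 / \<epsilon>\<^sup>2) * w n) sequentially"
    using eventually_ge_at_top[of m]
  proof eventually_elim
    case (elim n)
    then have "real n > 0" using m_pos by simp
    with bound[of n] elim show ?case by (simp add: divide_simps mult_ac)
  qed
  then show ?thesis
    by (rule summable_comparison_test_ev) (intro summable_mult w_summable)
qed

text \<open>Two-sided events \<open>\<bar>X n\<bar> > b n\<close> need not be negatively correlated,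
  but one-sided tails are. The converse Borel--Cantelli lemma is applied to each tail separately,
  and the two series are added.\<close>

lemma (in norming) kappa_integrable_of_AE_small:
  fixes X :: "nat \<Rightarrow> 'a \<Rightarrow> real"
  assumes "prob_space M" and X: "pairwise_neg_dependent M X {1..}"
    and D: "\<And>n. n \<ge> 1 \<Longrightarrow> distr M borel (X n) = D"
    and small: "AE \<omega> in M. eventually (\<lambda>n. \<bar>X n \<omega>\<bar> < b n) sequentially"
  shows "(\<integral>\<^sup>+x. ennreal (kappa \<bar>x\<bar>) \<partial>D) < \<infinity>"
proof (rule kappa_integrable_of_summable_tails)
  interpret prob_space M by fact
  have Xm: "random_variable borel (X i)" if "i \<ge> 1" for i
    using X that by (auto simp: pairwise_neg_dependent_def)
  have nd: "\<P>(\<omega> in M. X i \<omega> \<le> x \<and> X j \<omega> \<le> y) \<le> \<P>(\<omega> in M. X i \<omega> \<le> x) * \<P>(\<omega> in M. X j \<omega> \<le> y)"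
    if "i \<ge> 1" "j \<ge> 1" "i \<noteq> j" for i j x y
    using X that by (auto simp: pairwise_neg_dependent_def)
  show "prob_space D" using D[of 1] prob_space_distr[OF Xm[of 1]] by simp
  show sD: "sets D = sets borel" using D[of 1] by auto
  \<comment> \<open>The shift by \<open>m \<ge> 1\<close> avoids index \<open>0\<close>, at which
    nothing is assumed of \<open>X\<close>.\<close>
  have [measurable]: "random_variable borel (X (n + m))" for n using m_pos by (intro Xm) auto
  have small': "AE \<omega> in M. eventually (\<lambda>n. \<bar>X (n + m) \<omega>\<bar> < b (n + m)) sequentially"
    using small by eventually_elim (rule sequentially_offset)
  have up: "summable (\<lambda>n. \<P>(\<omega> in M. X (n + m) \<omega> > b (n + m)))"
  proof (rule summable_prob_of_neg_correlated)
    fix i j :: nat assume "i \<noteq> j"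
    then show "prob ({\<omega>\<in>space M. X (i + m) \<omega> > b (i + m)} \<inter> {\<omega>\<in>space M. X (j + m) \<omega> > b (j + m)})
      \<le> \<P>(\<omega> in M. X (i + m) \<omega> > b (i + m)) * \<P>(\<omega> in M. X (j + m) \<omega> > b (j + m))"
      using neg_dependent_upper[OF _ _ nd, of "i + m" "j + m" "b (i + m)" "b (j + m)"] m_pos
      by (simp add: Collect_conj_eq[symmetric] Int_def conj_ac cong: conj_cong)
  next
    show "AE \<omega> in M. eventually (\<lambda>n. \<omega> \<notin> {\<omega>\<in>space M. X (n + m) \<omega> > b (n + m)}) sequentially"
      using small' by eventually_elim (auto elim!: eventually_mono)
  qed measurable
  \<comment> \<open>The non-strict lower tail fits the definition of negative dependence; the strict
    bound in \<open>small'\<close> still excludes it eventually.\<close>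
  have low: "summable (\<lambda>n. \<P>(\<omega> in M. X (n + m) \<omega> \<le> - b (n + m)))"
  proof (rule summable_prob_of_neg_correlated)
    fix i j :: nat assume "i \<noteq> j"
    then show "prob ({\<omega>\<in>space M. X (i + m) \<omega> \<le> - b (i + m)} \<inter> {\<omega>\<in>space M. X (j + m) \<omega> \<le> - b (j + m)})
      \<le> \<P>(\<omega> in M. X (i + m) \<omega> \<le> - b (i + m)) * \<P>(\<omega> in M. X (j + m) \<omega> \<le> - b (j + m))"
      using nd[of "i + m" "j + m" "- b (i + m)" "- b (j + m)"] m_pos
      by (simp add: Collect_conj_eq[symmetric] Int_def conj_ac cong: conj_cong)
  next
    show "AE \<omega> in M. eventually (\<lambda>n. \<omega> \<notin> {\<omega>\<in>space M. X (n + m) \<omega> \<le> - b (n + m)}) sequentially"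
      using small' by eventually_elim (auto elim!: eventually_mono)
  qed measurable
  show "summable (\<lambda>n. measure D {x. b (n + m) < \<bar>x\<bar>})"
  proof (rule summable_comparison_test'[OF summable_add[OF up low], where N=0])
    fix n :: nat
    have "measure D {x. b (n + m) < \<bar>x\<bar>} = prob (X (n + m) -` {x. b (n + m) < \<bar>x\<bar>} \<inter> space M)"
      using m_pos by (subst D[of "n + m", symmetric]) (auto simp: measure_distr)
    also have "\<dots> \<le> prob ({\<omega>\<in>space M. X (n + m) \<omega> > b (n + m)} \<union> {\<omega>\<in>space M. X (n + m) \<omega> \<le> - b (n + m)})"
      by (intro finite_measure_mono) auto
    also have "\<dots> \<le> \<P>(\<omega> in M. X (n + m) \<omega> > b (n + m)) + \<P>(\<omega> in M. X (n + m) \<omega> \<le> - b (n + m))"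
      by (intro measure_Un_le) auto
    finally show "norm (measure D {x. b (n + m) < \<bar>x\<bar>})
        \<le> \<P>(\<omega> in M. X (n + m) \<omega> > b (n + m)) + \<P>(\<omega> in M. X (n + m) \<omega> \<le> - b (n + m))" by simp
  qed
qed

text \<open>With \<open>n = kappa x - 1\<close> we have \<open>b n < x \<le> b (n + 1) \<le> 4 b n\<close>, and \<open>b n L (b n) \<sim> n\<close> is the
  second conjugacy relation; uniformity of slow variation carries this from \<open>b n\<close> to \<open>x + A\<close>.\<close>

lemma kappa_comparison:
  assumes "norming (\<lambda>n. Lt (real n)) m"
    and L: "slowly_varying A L" and Lt: "slowly_varying A Lt"
    and conj: "((\<lambda>x. Lt x * L (x * Lt x)) \<longlongrightarrow> 1) at_top"
  defines "\<kappa> \<equiv> norming.kappa (\<lambda>n. Lt (real n)) m"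
  shows "eventually (\<lambda>x. x * L (x + A) \<le> 16 * \<kappa> x \<and> \<kappa> x \<le> 8 * (x * L (x + A))) at_top"
proof -
  interpret norming "\<lambda>n. Lt (real n)" m by fact
  have A: "A > 0" using L by (simp add: slowly_varying_def)
  \<comment> \<open>The range \<open>{1..5}\<close> covers \<open>(x + A) / b n\<close> once
    \<open>b n < x \<le> 4 * b n\<close> and \<open>A \<le> b n\<close>.\<close>
  define P where "P n \<longleftrightarrow> Lt (real (2 * n)) \<le> 2 * Lt (real n) \<and> Lt (real n) * L (b n) \<in> {1/2..2} \<and> A \<le> b n
      \<and> (\<forall>c\<in>{1..5}. L (c * b n) \<le> 2 * L (b n) \<and> L (b n) \<le> 2 * L (c * b n))" for n
  have "eventually P sequentially"
  proof -
    have "eventually (\<lambda>x. Lt (2 * x) \<le> 2 * Lt x) at_top"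
      using slowly_varying_two_sided_bound[OF Lt, of 2] by (auto elim!: eventually_mono)
    from eventually_compose_filterlim[OF this filterlim_real_sequentially]
    have e1: "eventually (\<lambda>n. Lt (real (2 * n)) \<le> 2 * Lt (real n)) sequentially" by simp
    have "eventually (\<lambda>x. dist (Lt x * L (x * Lt x)) 1 < 1/2) at_top"
      using tendstoD[OF conj, of "1/2"] by simp
    from eventually_compose_filterlim[OF this filterlim_real_sequentially]
    have e2: "eventually (\<lambda>n. Lt (real n) * L (b n) \<in> {1/2..2}) sequentially"
      by eventually_elim (auto simp: b_def dist_real_def abs_if split: if_splits)
    have e3: "eventually (\<lambda>n. A \<le> b n) sequentially" using b_lim by (simp add: filterlim_at_top)
    have e4: "eventually (\<lambda>n. \<forall>c\<in>{1..5}. L (c * b n) \<le> 2 * L (b n) \<and> L (b n) \<le> 2 * L (c * b n)) sequentially"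
      by (rule eventually_compose_filterlim[OF slowly_varying_two_sided_bound[OF L] b_lim]) simp
    show ?thesis unfolding P_def using e1 e2 e3 e4 by eventually_elim blast
  qed
  then obtain n0 where n0: "\<And>n. n \<ge> n0 \<Longrightarrow> P n" by (auto simp: eventually_sequentially)
  show ?thesis
    using eventually_gt_at_top[of "b (max m n0)"] unfolding \<kappa>_def
  proof eventually_elim
    case (elim x)
    then have k: "max m n0 < kappa x" using less_kappa_iff[of "max m n0" x] by simp
    define n where "n = kappa x - 1"
    have kn: "kappa x = Suc n" and nm: "m \<le> n" and "n0 \<le> n" using k by (auto simp: n_def)
    have n1: "real n \<ge> 1" using nm m_pos by simp
    from n0[OF \<open>n0 \<le> n\<close>] have p: "Lt (real (2 * n)) \<le> 2 * Lt (real n)" "1/2 \<le> Lt (real n) * L (b n)"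
      "Lt (real n) * L (b n) \<le> 2" "A \<le> b n"
      "\<And>c. c \<in> {1..5} \<Longrightarrow> L (c * b n) \<le> 2 * L (b n) \<and> L (b n) \<le> 2 * L (c * b n)"
      by (auto simp: P_def)
    have bn: "b n > 0" using b_pos[OF nm] .
    have lower: "b n < x" using less_kappa_iff[OF nm, of x] kn by simp
    \<comment> \<open>Doubling the index costs \<open>2\<close> from the factor \<open>n\<close> and
      \<open>2\<close> from \<open>Lt\<close>, hence \<open>4\<close>.\<close>
    have "x \<le> b (Suc n)" using kappa_props(2)[of x] kn by simp
    also have "\<dots> \<le> b (2 * n)" using nm n1 by (intro b_mono) auto
    also have "\<dots> \<le> (2 * real n) * (2 * Lt (real n))" using mult_left_mono[OF p(1), of "2 * real n"] by (simp add: b_def)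
    also have "\<dots> = 4 * b n" by (simp add: b_def)
    finally have upper: "x \<le> 4 * b n" .
    have "(x + A) / b n \<in> {1..5}" using bn lower upper p(4) A by (simp add: field_simps)
    from p(5)[OF this] have Lx: "L (x + A) \<le> 2 * L (b n)" "L (b n) \<le> 2 * L (x + A)"
      using bn by auto
    have Lpos: "L (x + A) > 0" "L (b n) > 0"
      using L lower bn p(4) by (auto simp: slowly_varying_def)
    have bL: "b n * L (b n) = real n * (Lt (real n) * L (b n))" by (simp add: b_def)
    have "x * L (x + A) \<le> (4 * b n) * (2 * L (b n))"
      using upper Lx bn Lpos by (intro mult_mono) auto
    also have "\<dots> = 8 * (real n * (Lt (real n) * L (b n)))" using bL by simp
    also have "\<dots> \<le> 8 * (real n * 2)" using p(3) by (intro mult_left_mono) auto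
    finally have 1: "x * L (x + A) \<le> 16 * kappa x" by (simp add: kn)
    have "real n * (1/2) \<le> b n * L (b n)" unfolding bL using p(2) by (intro mult_left_mono) auto
    also have "\<dots> \<le> x * (2 * L (x + A))" using lower Lx bn Lpos by (intro mult_mono) auto
    finally have "real n \<le> 4 * (x * L (x + A))" by simp
    \<comment> \<open>Here \<open>kappa x = n + 1 \<le> 2 * n\<close> turns the constant
      \<open>4\<close> into \<open>8\<close>.\<close>
    then have "kappa x \<le> 8 * (x * L (x + A))" using n1 kn by simp
    with 1 show ?case by simp
  qed
qed

lemma nn_integral_finite_of_affine_bound:
  fixes f g :: "'a \<Rightarrow> real"
  assumes "finite_measure D" and [measurable]: "g \<in> borel_measurable D"
    and g: "\<And>x. 0 \<le> g x" and le: "\<And>x. f x \<le> B + C * g x" and B: "0 \<le> B" and C: "0 \<le> C"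
    and fin: "(\<integral>\<^sup>+x. ennreal (g x) \<partial>D) < \<infinity>"
  shows "(\<integral>\<^sup>+x. ennreal (f x) \<partial>D) < \<infinity>"
proof -
  interpret finite_measure D by fact
  have "(\<integral>\<^sup>+x. ennreal (f x) \<partial>D) \<le> (\<integral>\<^sup>+x. ennreal B + ennreal C * ennreal (g x) \<partial>D)"
    using le g B C by (intro nn_integral_mono) (simp flip: ennreal_mult ennreal_plus add: ennreal_leI)
  also have "\<dots> = ennreal B * emeasure D (space D) + ennreal C * (\<integral>\<^sup>+x. ennreal (g x) \<partial>D)"
    by (simp add: nn_integral_add nn_integral_cmult)
  also have "\<dots> < \<infinity>" using fin by (simp add: ennreal_mult_eq_top_iff less_top[symmetric])
  finally show ?thesis .
qed

text \<open>\<open>kappa_comparison\<close> settles large arguments. On the remaining bounded range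
  local boundedness of \<open>L\<close> controls one integrand and monotonicity of
  \<open>kappa\<close> the other, so each is bounded affinely by the other.\<close>

lemma moment_iff_kappa_integrable:
  assumes "norming (\<lambda>n. Lt (real n)) m"
    and L: "slowly_varying A L" and Lt: "slowly_varying A Lt"
    and conj: "((\<lambda>x. Lt x * L (x * Lt x)) \<longlongrightarrow> 1) at_top"
    and bdd: "\<And>a b. A \<le> a \<Longrightarrow> bounded (L ` {a..b})"
    and "finite_measure D" and [measurable_cong]: "sets D = sets borel"
  defines "\<kappa> \<equiv> norming.kappa (\<lambda>n. Lt (real n)) m"
  shows "(\<integral>\<^sup>+x. ennreal (\<bar>x\<bar> * L (\<bar>x\<bar> + A)) \<partial>D) < \<infinity> \<longleftrightarrow> (\<integral>\<^sup>+x. ennreal (\<kappa> \<bar>x\<bar>) \<partial>D) < \<infinity>"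
proof -
  interpret norming "\<lambda>n. Lt (real n)" m by fact
  have A: "A > 0" and Lpos: "\<And>x. x \<ge> A \<Longrightarrow> L x > 0"
    and Lm[measurable]: "L \<in> borel_measurable (restrict_space borel {A..})"
    using L unfolding slowly_varying_def by blast+
  let ?\<phi> = "\<lambda>x. x * L (x + A)"
  have \<phi>0: "0 \<le> ?\<phi> \<bar>x\<bar>" for x using Lpos[of "\<bar>x\<bar> + A"] by simp
  have "(\<lambda>x::real. \<bar>x\<bar> + A) \<in> borel \<rightarrow>\<^sub>M restrict_space borel {A..}"
    by (rule measurable_restrict_space2) auto
  from measurable_compose[OF this Lm]
  have [measurable]: "(\<lambda>x. \<bar>x\<bar> * L (\<bar>x\<bar> + A)) \<in> borel_measurable D" by measurable
  obtain x0 where x0: "\<And>x. x \<ge> x0 \<Longrightarrow> ?\<phi> x \<le> 16 * kappa x \<and> kappa x \<le> 8 * ?\<phi> x"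
    using kappa_comparison[OF assms(1) L Lt conj] by (auto simp: eventually_at_top_linorder)
  obtain B where B: "\<And>x. x \<in> {A..max x0 0 + A} \<Longrightarrow> \<bar>L x\<bar> \<le> B"
    using bdd[of A "max x0 0 + A"] by (force simp: bounded_iff)
  have "0 \<le> B" using B[of A] by auto
  have b1: "?\<phi> \<bar>x\<bar> \<le> max x0 0 * B + 16 * real (kappa \<bar>x\<bar>)" for x
  proof (cases "\<bar>x\<bar> \<ge> x0")
    case True
    then show ?thesis using x0[of "\<bar>x\<bar>"] \<open>0 \<le> B\<close> by (auto intro: add_increasing)
  next
    case False
    then have "?\<phi> \<bar>x\<bar> \<le> max x0 0 * B"
      using B[of "\<bar>x\<bar> + A"] \<open>0 \<le> B\<close> by (intro mult_mono') (use Lpos[of "\<bar>x\<bar> + A"] in auto)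
    then show ?thesis by simp
  qed
  have b2: "kappa \<bar>x\<bar> \<le> kappa x0 + 8 * ?\<phi> \<bar>x\<bar>" for x
    using x0[of "\<bar>x\<bar>"] kappa_mono[of "\<bar>x\<bar>" x0] \<phi>0[of x] by (cases "\<bar>x\<bar> \<ge> x0") auto
  show ?thesis unfolding \<kappa>_def
  proof
    assume "(\<integral>\<^sup>+x. ennreal (?\<phi> \<bar>x\<bar>) \<partial>D) < \<infinity>"
    then show "(\<integral>\<^sup>+x. ennreal (kappa \<bar>x\<bar>) \<partial>D) < \<infinity>"
      by (rule nn_integral_finite_of_affine_bound[OF \<open>finite_measure D\<close> _ \<phi>0 b2, rotated 3]) auto
  next
    assume "(\<integral>\<^sup>+x. ennreal (kappa \<bar>x\<bar>) \<partial>D) < \<infinity>"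
    then show "(\<integral>\<^sup>+x. ennreal (?\<phi> \<bar>x\<bar>) \<partial>D) < \<infinity>"
      by (rule nn_integral_finite_of_affine_bound[OF \<open>finite_measure D\<close> _ _ b1, rotated 4])
        (use \<open>0 \<le> B\<close> in auto)
  qed
qed

text \<open>Nonnegativity makes unconditional and ordinary summability agree, and dropping finitely
  many indices preserves convergence.\<close>

lemma summable_on_atLeast_iff_summable:
  fixes f :: "nat \<Rightarrow> real"
  assumes "\<And>n. 0 \<le> f n"
  shows "f summable_on {m..} \<longleftrightarrow> summable f"
proof -
  have "f summable_on {m..} \<longleftrightarrow> (\<lambda>n. if m \<le> n then f n else 0) summable_on UNIV"
    by (rule summable_on_cong_neutral) auto
  also have "\<dots> \<longleftrightarrow> summable (\<lambda>n. if m \<le> n then f n else 0)"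
    using assms by (intro summable_on_UNIV_nonneg_real_iff) auto
  also have "\<dots> \<longleftrightarrow> summable f"
    by (rule summable_cong, rule eventually_mono[OF eventually_ge_at_top[of m]]) simp
  finally show ?thesis .
qed

section \<open>The three equivalences, routed through integrability of \<open>kappa\<close>\<close>

theorem theorem4p1:
  fixes M :: "'a measure" and X :: "nat \<Rightarrow> 'a \<Rightarrow> real"
    and N :: "'b measure" and Y :: "'b \<Rightarrow> real"
    and L Lt :: "real \<Rightarrow> real" and A :: real
  assumes "prob_space M" and "prob_space N"
    and "pairwise_neg_dependent M X {1..}"
    and "Y \<in> borel_measurable N"
    and "\<And>n. n \<ge> 1 \<Longrightarrow> distr M borel (X n) = distr N borel Y"
    and "A > 0"
    and "slowly_varying A L"
    and "de_Bruijn_conjugate A L Lt"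
    and "\<And>a b. A \<le> a \<Longrightarrow> bounded (L ` {a..b})"
    and "\<And>a b. A \<le> a \<Longrightarrow> bounded (Lt ` {a..b})"
    and "mono_on {A..} Lt"
    and "filterlim Lt at_top at_top"
  shows
    "((\<integral>\<^sup>+ \<omega>. ennreal (\<bar>Y \<omega>\<bar> * L (\<bar>Y \<omega>\<bar> + A)) \<partial>N) < \<infinity>
      \<longleftrightarrow>
      (\<forall>\<epsilon>>0. (\<lambda>n::nat. 1 / real n *
          \<P>(\<omega> in M. (MAX k\<in>{1..n}. \<bar>\<Sum>i=1..k. X i \<omega>\<bar>) > \<epsilon> * real n * Lt (real n)))
        summable_on {n. n \<ge> 1 \<and> real n \<ge> A}))
     \<and>
     ((\<forall>\<epsilon>>0. (\<lambda>n::nat. 1 / real n *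
          \<P>(\<omega> in M. (MAX k\<in>{1..n}. \<bar>\<Sum>i=1..k. X i \<omega>\<bar>) > \<epsilon> * real n * Lt (real n)))
        summable_on {n. n \<ge> 1 \<and> real n \<ge> A})
      \<longleftrightarrow>
      (AE \<omega> in M. (\<lambda>n. (\<Sum>i=1..n. \<bar>X i \<omega>\<bar>) / (real n * Lt (real n))) \<longlonglongrightarrow> 0))"
proof -
  interpret prob_space M by fact
  interpret N: prob_space N by fact
  have [measurable]: "Y \<in> borel_measurable N" by fact
  have Lt: "slowly_varying A Lt" and conj: "((\<lambda>x. Lt x * L (x * Lt x)) \<longlongrightarrow> 1) at_top"
    using assms(8) by (auto simp: de_Bruijn_conjugate_def)
  have Ltpos: "\<And>x. A \<le> x \<Longrightarrow> 0 < Lt x" and Lm[measurable]: "L \<in> borel_measurable (restrict_space borel {A..})"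
    using Lt assms(7) unfolding slowly_varying_def by blast+
  \<comment> \<open>As \<open>A > 0\<close>, rounding up gives \<open>m \<ge> 1\<close>, so both
    conditions on the index set become \<open>m \<le> n\<close>.\<close>
  define m where "m = nat \<lceil>A\<rceil>"
  have m_iff: "m \<le> n \<longleftrightarrow> n \<ge> 1 \<and> A \<le> real n" for n
    using \<open>A > 0\<close> unfolding m_def by linarith
  have domain: "{n. n \<ge> 1 \<and> real n \<ge> A} = {m..}" using m_iff by auto
  have norming: "norming (\<lambda>n. Lt (real n)) m"
  proof
    show "1 \<le> m" using m_iff[of m] by simp
    show "Lt (real i) \<le> Lt (real j)" if "m \<le> i" "i \<le> j" for i j
      using that m_iff[of i] m_iff[of j] by (intro mono_onD[OF assms(11)]) auto
    show "0 < Lt (real m)" using m_iff[of m] by (intro Ltpos) simp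
    show "filterlim (\<lambda>n. Lt (real n)) at_top sequentially"
      by (rule filterlim_compose[OF assms(12) filterlim_real_sequentially])
  qed
  interpret norming "\<lambda>n. Lt (real n)" m by (rule norming)
  define D where "D = distr N borel Y"
  have D: "prob_space D" "sets D = sets borel" "\<And>n. n \<ge> 1 \<Longrightarrow> distr M borel (X n) = D"
    using assms(5) by (auto simp: D_def intro: N.prob_space_distr)
  interpret D: prob_space D by fact
  have Xm: "random_variable borel (X i)" if "i \<ge> 1" for i
    using assms(3) that by (auto simp: pairwise_neg_dependent_def)
  define S where "S n \<omega> = (MAX k\<in>{1..n}. \<bar>\<Sum>i=1..k. X i \<omega>\<bar>)" for n \<omega>
  define T where "T n \<omega> = (\<Sum>i=1..n. \<bar>X i \<omega>\<bar>)" for n \<omega>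
  let ?p = "\<lambda>\<epsilon> S n. 1 / real n * \<P>(\<omega> in M. S n \<omega> > \<epsilon> * b n)"
  have Sm: "random_variable borel (S n)" for n
    unfolding S_def using Xm by (intro borel_measurable_Max borel_measurable_abs borel_measurable_sum) auto
  have Tm: "random_variable borel (T n)" for n
    unfolding T_def using Xm by (intro borel_measurable_abs borel_measurable_sum) auto
  have ST: "S n \<omega> \<le> T n \<omega>" if "n \<ge> 1" for n \<omega>
    unfolding S_def
  proof (rule Max.boundedI)
    fix a assume "a \<in> (\<lambda>k. \<bar>\<Sum>i=1..k. X i \<omega>\<bar>) ` {1..n}"
    then obtain k where k: "k \<in> {1..n}" "a = \<bar>\<Sum>i=1..k. X i \<omega>\<bar>" by auto
    have "a \<le> T k \<omega>" unfolding k T_def by (rule sum_abs)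
    also have "\<dots> \<le> T n \<omega>" unfolding T_def using k by (intro sum_mono2) auto
    finally show "a \<le> T n \<omega>" .
  qed (use that in auto)
  have partial: "\<bar>\<Sum>i=1..k. X i \<omega>\<bar> \<le> S n \<omega>" if "k \<in> {1..n}" for k n \<omega>
    unfolding S_def using that by (intro Max_ge) auto
  \<comment> \<open>A summand is the difference of two consecutive partial sums, both entering the
    maximum. The case \<open>n = 1\<close> is separate because the empty sum is not among
    them.\<close>
  have X_le: "\<bar>X n \<omega>\<bar> \<le> 2 * S n \<omega>" if n1: "n \<ge> 1" for n \<omega>
  proof (cases "n = 1")
    case True
    then show ?thesis using partial[of 1 1 \<omega>] by auto
  next
    case False
    then obtain j where j: "n = Suc j" "j \<ge> 1" using n1 by (cases n) auto
    have "X n \<omega> = (\<Sum>i=1..n. X i \<omega>) - (\<Sum>i=1..j. X i \<omega>)" using j by simp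
    then show ?thesis using partial[of n n \<omega>] partial[of j n \<omega>] j by auto
  qed
  have growth: "eventually (\<lambda>n. b (4 * n) \<le> 8 * b n) sequentially"
  proof -
    have "eventually (\<lambda>x. Lt (4 * x) \<le> 2 * Lt x) at_top"
      using slowly_varying_two_sided_bound[OF Lt, of 4] by (auto elim!: eventually_mono)
    from eventually_compose_filterlim[OF this filterlim_real_sequentially]
    show ?thesis
    proof eventually_elim
      case (elim n)
      from mult_left_mono[OF this, of "4 * real n"] show ?case by (simp add: b_def)
    qed
  qed
  \<comment> \<open>The hub: (i), (ii) and (iii) are each shown equivalent to this
    condition.\<close>
  let ?kint = "(\<integral>\<^sup>+x. ennreal (kappa \<bar>x\<bar>) \<partial>D) < \<infinity>"
  have Lm': "(\<lambda>x::real. \<bar>x\<bar> + A) \<in> borel \<rightarrow>\<^sub>M restrict_space borel {A..}"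
    by (rule measurable_restrict_space2) auto
  have "(\<integral>\<^sup>+ \<omega>. ennreal (\<bar>Y \<omega>\<bar> * L (\<bar>Y \<omega>\<bar> + A)) \<partial>N) = (\<integral>\<^sup>+x. ennreal (\<bar>x\<bar> * L (\<bar>x\<bar> + A)) \<partial>D)"
    unfolding D_def using measurable_compose[OF Lm' Lm] by (subst nn_integral_distr) auto
  then have i_iff: "(\<integral>\<^sup>+ \<omega>. ennreal (\<bar>Y \<omega>\<bar> * L (\<bar>Y \<omega>\<bar> + A)) \<partial>N) < \<infinity> \<longleftrightarrow> ?kint"
    using moment_iff_kappa_integrable[OF norming assms(7) Lt conj assms(9) D.finite_measure_axioms D(2)] by simp
  have ii_iff: "(\<forall>\<epsilon>>0. (\<lambda>n::nat. 1 / real n *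
          \<P>(\<omega> in M. (MAX k\<in>{1..n}. \<bar>\<Sum>i=1..k. X i \<omega>\<bar>) > \<epsilon> * real n * Lt (real n)))
        summable_on {n. n \<ge> 1 \<and> real n \<ge> A}) \<longleftrightarrow> (\<forall>\<epsilon>>0. summable (?p \<epsilon> S))"
    unfolding domain by (subst summable_on_atLeast_iff_summable) (auto simp: S_def b_def mult.assoc)
  have iii_eq: "(AE \<omega> in M. (\<lambda>n. (\<Sum>i=1..n. \<bar>X i \<omega>\<bar>) / (real n * Lt (real n))) \<longlonglongrightarrow> 0)
      \<longleftrightarrow> (AE \<omega> in M. (\<lambda>n. T n \<omega> / b n) \<longlonglongrightarrow> 0)"
    by (simp add: T_def b_def)
  have sumT: "summable (?p \<epsilon> T)" if "?kint" "\<epsilon> > 0" for \<epsilon>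
    unfolding T_def by (rule summable_deviation_probs[OF assms(1,3) D(3) that]) auto
  have sumS: "summable (?p \<epsilon> S)" if "?kint" "\<epsilon> > 0" for \<epsilon>
  proof (rule summable_comparison_test'[OF sumT[OF that], where N = 1])
    fix n :: nat assume "1 \<le> n"
    then have "\<P>(\<omega> in M. S n \<omega> > \<epsilon> * b n) \<le> \<P>(\<omega> in M. T n \<omega> > \<epsilon> * b n)"
      using ST[of n] Tm[of n] by (intro finite_measure_mono) (auto intro: less_le_trans)
    then show "norm (?p \<epsilon> S n) \<le> ?p \<epsilon> T n" by (simp add: divide_right_mono)
  qed
  have limT: "AE \<omega> in M. (\<lambda>n. T n \<omega> / b n) \<longlonglongrightarrow> 0" if "?kint"
  proof (rule AE_tendsto_0_of_summable_prob[OF Tm _ _ b_mono b_pos[OF order_refl] growth _ sumT[OF that]])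
    show "T n \<omega> \<le> T k \<omega>" if "n \<le> k" for n k \<omega>
      unfolding T_def using that by (intro sum_mono2) auto
    show "0 \<le> T n \<omega>" for n \<omega> unfolding T_def by (intro sum_nonneg) auto
  qed auto
  \<comment> \<open>The maximum \<open>S\<close> is itself nondecreasing in \<open>n\<close>, so the
    dyadic argument applies to it directly, without a maximal inequality.\<close>
  have limS: "AE \<omega> in M. (\<lambda>n. S n \<omega> / b n) \<longlonglongrightarrow> 0" if "\<And>\<epsilon>. \<epsilon> > 0 \<Longrightarrow> summable (?p \<epsilon> S)"
  proof (rule AE_tendsto_0_of_summable_prob[OF Sm _ _ b_mono b_pos[OF order_refl] growth _ that])
    show "S n \<omega> \<le> S k \<omega>" if "1 \<le> n" "n \<le> k" for n k \<omega>
      unfolding S_def using that by (intro Max_mono) auto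
    show "0 \<le> S n \<omega>" if "1 \<le> n" for n \<omega>
      using partial[of 1 n \<omega>] that by (auto intro: order_trans[OF abs_ge_zero])
  qed auto
  \<comment> \<open>The general \<open>Z\<close> serves for both \<open>S\<close> and
    \<open>T\<close>; eventually \<open>Z n \<omega> < b n / 2\<close>, which gives
    \<open>\<bar>X n \<omega>\<bar> < b n\<close>.\<close>
  have kint_of_lim: "?kint" if lim: "AE \<omega> in M. (\<lambda>n. Z n \<omega> / b n) \<longlonglongrightarrow> 0" and Z: "\<And>n \<omega>. n \<ge> 1 \<Longrightarrow> \<bar>X n \<omega>\<bar> \<le> 2 * Z n \<omega>" for Z
  proof (rule kappa_integrable_of_AE_small[OF assms(1,3) D(3)])
    show "AE \<omega> in M. eventually (\<lambda>n. \<bar>X n \<omega>\<bar> < b n) sequentially"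
      using lim
    proof eventually_elim
      case (elim \<omega>)
      have "eventually (\<lambda>n. Z n \<omega> / b n < 1/2) sequentially"
        using order_tendstoD(2)[OF elim, of "1/2"] by simp
      with eventually_ge_at_top[of m] show ?case
      proof eventually_elim
        case (elim n)
        then have "Z n \<omega> < b n / 2" using b_pos[of n] by (simp add: field_simps)
        then show ?case using Z[of n \<omega>] elim m_iff[of n] by simp
      qed
    qed
  qed auto
  have XT: "\<bar>X n \<omega>\<bar> \<le> 2 * T n \<omega>" if "n \<ge> 1" for n \<omega>
    using X_le[OF that, of \<omega>] ST[OF that, of \<omega>] by simp
  have "?kint \<longleftrightarrow> (\<forall>\<epsilon>>0. summable (?p \<epsilon> S))"
  proof
    assume "\<forall>\<epsilon>>0. summable (?p \<epsilon> S)"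
    then have "AE \<omega> in M. (\<lambda>n. S n \<omega> / b n) \<longlonglongrightarrow> 0" by (intro limS) simp
    then show ?kint using X_le by (rule kint_of_lim)
  qed (intro allI impI sumS)
  moreover have "?kint \<longleftrightarrow> (AE \<omega> in M. (\<lambda>n. T n \<omega> / b n) \<longlonglongrightarrow> 0)"
    using limT kint_of_lim[OF _ XT] by (rule iffI)
  ultimately show ?thesis unfolding i_iff ii_iff iii_eq by (intro conjI) (simp_all only:)
qed

end
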